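(* Let $k=\mathbb F_8=\mathbb F_2(\alpha)$, where $\alpha^3=\alpha+1$, and let $G=\langle\sigma_1,\sigma_2,\sigma_3,\sigma_4\rangle$ act faithfully on $S=k[x_1,x_2,y_1,y_2]$ by fixing $x_1,x_2$ and by $$\begin{aligned} \sigma_1(y_1)&=y_1+x_1, & \sigma_1(y_2)&=y_2,\\ \sigma_2(y_1)&=y_1, & \sigma_2(y_2)&=y_2+x_2,\\ \sigma_3(y_1)&=y_1+(1+\alpha^2)x_1+x_2, & \sigma_3(y_2)&=y_2+\alpha x_1+\alpha^2x_2,\\ \sigma_4(y_1)&=y_1+(1+\alpha^2)x_1+\alpha^2x_2, & \sigma_4(y_2)&=y_2+(1+\alpha^2)x_1+\alpha^2x_2. \end{aligned}$$ Then $G\cong C_2^4$ and $S^G$ is a polynomial algebra with minimal homogeneous generator degrees $1,1,4,4$. Every nonfixed linear form has orbit size $8$ or $16$. Consequently every nonlinear orbit norm belongs to $(S^G_+)^2$, so no nonlinear orbit norm can occur in a homogeneous minimal algebra-generating set. Thus Wehlau's norm conjecture is false even when the invariant ring is polynomial.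
   Context: $C_2$ is the cyclic group of order $2$. $S$ is the polynomial ring with its standard grading (all variables in degree $1$), and $G$ acts by graded $k$-algebra automorphisms; linear forms are the elements of $S_1$. $S^G$ is the graded subring of $G$-invariants, $S^G_+$ is its ideal of positive-degree elements, and $(S^G_+)^2$ is the square of this ideal in $S^G$. For a linear form $\ell$, the orbit norm is $N_G^{\mathrm{orb}}(\ell)=\prod_{m\in G\ell}m$, the product of the distinct elements of its orbit; it is called nonlinear precisely when $\ell$ is not fixed by $G$. Wehlau's norm conjecture (D. L. Wehlau, "Some problems in invariant theory", 2004, and his web page of conjectures) concerns invariant rings of modular representations (characteristic of the field dividing the group order); as it is used here, it predicts that some nonlinear orbit norm of a linear form occurs in a homogeneous minimal algebra-generating set of the invariant ring, either under the hypothesis that the invariant ring is a polynomial algebra or, in its stronger unrestricted form, without that hypothesis. *)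

theory Defs
  imports
    HOL.Hull
    "HOL-Library.Poly_Mapping"
    "HOL-Library.Multiset"
    "HOL-Library.Z2"
    "HOL-Algebra.Product_Groups"
    "HOL-Algebra.Group_Action"
    "HOL-Algebra.Ideal_Product"
begin

section \<open>The field with eight elements\<close>

text \<open>\<open>F8 a b c\<close> is the element a + b \<alpha> + c \<alpha>^2 of F_2[\<alpha>], where \<alpha>^3 = \<alpha> + 1.\<close>

datatype f8 = F8 bit bit bit

instantiation f8 :: comm_ring_1
begin

definition zero_f8 :: f8 where "0 = F8 0 0 0"

definition one_f8 :: f8 where "1 = F8 1 0 0"

fun plus_f8 :: "f8 \<Rightarrow> f8 \<Rightarrow> f8" where
  "F8 a0 a1 a2 + F8 b0 b1 b2 = F8 (a0 + b0) (a1 + b1) (a2 + b2)"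

fun uminus_f8 :: "f8 \<Rightarrow> f8" where
  "- F8 a0 a1 a2 = F8 (- a0) (- a1) (- a2)"

definition minus_f8 :: "f8 \<Rightarrow> f8 \<Rightarrow> f8" where "x - y = x + - (y :: f8)"

text \<open>Reduced by \<alpha>^3 = \<alpha> + 1 and \<alpha>^4 = \<alpha>^2 + \<alpha>.\<close>

fun times_f8 :: "f8 \<Rightarrow> f8 \<Rightarrow> f8" where
  "F8 a0 a1 a2 * F8 b0 b1 b2 =
     F8 (a0 * b0 + (a1 * b2 + a2 * b1))
        (a0 * b1 + a1 * b0 + (a1 * b2 + a2 * b1) + a2 * b2)
        (a0 * b2 + a1 * b1 + a2 * b0 + a2 * b2)"

instance
proof
  fix a b c :: f8
  show "a + b + c = a + (b + c)"
    by (cases a; cases b; cases c) (simp only: plus_f8.simps add_ac)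
  show "a + b = b + a"
    by (cases a; cases b) (simp only: plus_f8.simps add_ac)
  show "0 + a = a"
    by (cases a) (simp add: zero_f8_def)
  show "- a + a = 0"
    by (cases a) (simp add: zero_f8_def)
  show "a - b = a + - b"
    by (simp add: minus_f8_def)
  show "a * b * c = a * (b * c)"
    by (cases a; cases b; cases c) (simp only: times_f8.simps plus_f8.simps algebra_simps)
  show "a * b = b * a"
    by (cases a; cases b) (simp only: times_f8.simps plus_f8.simps algebra_simps)
  show "1 * a = a"
    by (cases a) (simp add: one_f8_def)
  show "(a + b) * c = a * c + b * c"
    by (cases a; cases b; cases c) (simp only: times_f8.simps plus_f8.simps algebra_simps)
  show "(0::f8) \<noteq> 1"
    by (simp add: zero_f8_def one_f8_def)
qed

end

instantiation f8 :: field
begin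

definition inverse_f8 :: "f8 \<Rightarrow> f8" where "inverse (x :: f8) = x ^ 6"

definition divide_f8 :: "f8 \<Rightarrow> f8 \<Rightarrow> f8" where "x div y = x * inverse (y :: f8)"

instance
proof
  fix a b :: f8
  show "a \<noteq> 0 \<Longrightarrow> inverse a * a = 1"
  proof (cases a)
    fix a0 a1 a2 assume "a \<noteq> 0" "a = F8 a0 a1 a2"
    then show "inverse a * a = 1"
      by (cases a0; cases a1; cases a2)
        (simp_all add: inverse_f8_def zero_f8_def one_f8_def eval_nat_numeral)
  qed
  show "a div b = a * inverse b"
    by (simp add: divide_f8_def)
  show "inverse (0::f8) = 0"
    by (simp add: inverse_f8_def)
qed

end

lemma UNIV_f8: "(UNIV :: f8 set) = (\<lambda>(a, b, c). F8 a b c) ` ({0, 1} \<times> {0, 1} \<times> {0, 1})"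
proof -
  have "x \<in> (\<lambda>(a, b, c). F8 a b c) ` ({0, 1} \<times> {0, 1} \<times> {0, 1})" for x
  proof (cases x)
    case (F8 a b c)
    then have "x = (\<lambda>(a, b, c). F8 a b c) (a, b, c)" by simp
    moreover have "(a, b, c) \<in> {0, 1} \<times> {0, 1} \<times> {0, 1}"
      by (cases a; cases b; cases c) simp_all
    ultimately show ?thesis by (rule image_eqI)
  qed
  then show ?thesis by blast
qed

instance f8 :: finite
  by standard (simp add: UNIV_f8)

definition \<alpha> :: f8 where "\<alpha> = F8 0 1 0"

lemma alpha_cubed: "\<alpha> ^ 3 = \<alpha> + 1"
  by (simp add: \<alpha>_def one_f8_def eval_nat_numeral)

lemma card_f8: "card (UNIV :: f8 set) = 8"
proof -
  have "inj_on (\<lambda>(a, b, c). F8 a b c) ({0, 1} \<times> {0, 1} \<times> {0, 1})"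
    by (auto simp: inj_on_def)
  then show ?thesis
    unfolding UNIV_f8 by (simp add: card_image card_cartesian_product)
qed


section \<open>Polynomial rings\<close>

text \<open>The polynomial ring over \<open>'k\<close> in the variables \<open>'v\<close>, as the monoid algebra of the
  monomials \<open>'v \<Rightarrow>\<^sub>0 nat\<close> (finitely supported exponent vectors).\<close>

type_synonym ('v, 'k) mpoly = "('v \<Rightarrow>\<^sub>0 nat) \<Rightarrow>\<^sub>0 'k"

definition const :: "'k \<Rightarrow> ('v, 'k::comm_ring_1) mpoly" where
  "const c = Poly_Mapping.single 0 c"

definition var :: "'v \<Rightarrow> ('v, 'k::comm_ring_1) mpoly" where
  "var v = Poly_Mapping.single (Poly_Mapping.single v 1) 1"

definition mdeg :: "('v \<Rightarrow>\<^sub>0 nat) \<Rightarrow> nat" where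
  "mdeg m = (\<Sum>v\<in>Poly_Mapping.keys m. Poly_Mapping.lookup m v)"

definition homogeneous :: "nat \<Rightarrow> ('v, 'k::comm_ring_1) mpoly \<Rightarrow> bool" where
  "homogeneous d f \<longleftrightarrow> (\<forall>m\<in>Poly_Mapping.keys f. mdeg m = d)"

definition total_degree :: "('v, 'k::comm_ring_1) mpoly \<Rightarrow> nat" where
  "total_degree f = Max (insert 0 (mdeg ` Poly_Mapping.keys f))"

definition indets :: "('v, 'k::comm_ring_1) mpoly \<Rightarrow> 'v set" where
  "indets f = (\<Union>m\<in>Poly_Mapping.keys f. Poly_Mapping.keys m)"

text \<open>The k-algebra homomorphism sending each variable \<open>i\<close> to \<open>s i\<close>.\<close>

definition poly_eval ::
    "('i \<Rightarrow> ('v, 'k) mpoly) \<Rightarrow> ('i, 'k) mpoly \<Rightarrow> ('v, 'k::comm_ring_1) mpoly" where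
  "poly_eval s p =
     (\<Sum>m\<in>Poly_Mapping.keys p. const (Poly_Mapping.lookup p m) *
        (\<Prod>i\<in>Poly_Mapping.keys m. s i ^ Poly_Mapping.lookup m i))"

definition subalgebra :: "('v, 'k::comm_ring_1) mpoly set \<Rightarrow> bool" where
  "subalgebra A \<longleftrightarrow>
     range const \<subseteq> A \<and> (\<forall>f\<in>A. \<forall>g\<in>A. f + g \<in> A \<and> f * g \<in> A)"

text \<open>\<open>A\<close> is a polynomial algebra: for some finite set \<open>B\<close>, the evaluation homomorphism
  from the polynomial ring whose variables are the elements of \<open>B\<close> is an isomorphism
  onto \<open>A\<close>.\<close>

definition polynomial_algebra :: "('v, 'k::comm_ring_1) mpoly set \<Rightarrow> bool" where
  "polynomial_algebra A \<longleftrightarrow>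
     (\<exists>B. finite B \<and> bij_betw (poly_eval (\<lambda>b. b)) {p. indets p \<subseteq> B} A)"

definition homogeneous_minimal_generating_set ::
    "('v, 'k::comm_ring_1) mpoly set \<Rightarrow> ('v, 'k) mpoly set \<Rightarrow> bool" where
  "homogeneous_minimal_generating_set A B \<longleftrightarrow>
     (\<forall>b\<in>B. \<exists>d. homogeneous d b) \<and>
     subalgebra hull B = A \<and>
     (\<forall>C. C \<subset> B \<longrightarrow> subalgebra hull C \<noteq> A)"

definition minimal_generator_degrees ::
    "('v, 'k::comm_ring_1) mpoly set \<Rightarrow> nat multiset \<Rightarrow> bool" where
  "minimal_generator_degrees A M \<longleftrightarrow>
     (\<exists>B. homogeneous_minimal_generating_set A B) \<and>
     (\<forall>B. homogeneous_minimal_generating_set A B \<longrightarrow>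
        finite B \<and> image_mset total_degree (mset_set B) = M)"


section \<open>Group actions and invariants\<close>

definition graded_automorphism ::
    "(('v, 'k) mpoly \<Rightarrow> ('v, 'k::comm_ring_1) mpoly) \<Rightarrow> bool" where
  "graded_automorphism \<phi> \<longleftrightarrow>
     bij \<phi> \<and>
     (\<forall>f g. \<phi> (f + g) = \<phi> f + \<phi> g) \<and>
     (\<forall>f g. \<phi> (f * g) = \<phi> f * \<phi> g) \<and>
     (\<forall>c. \<phi> (const c) = const c) \<and>
     (\<forall>d f. homogeneous d f \<longrightarrow> homogeneous d (\<phi> f))"

definition graded_aut_group ::
    "(('v, 'k) mpoly \<Rightarrow> ('v, 'k::comm_ring_1) mpoly) monoid" where
  "graded_aut_group =
     \<lparr>carrier = {\<phi>. graded_automorphism \<phi>}, monoid.mult = (\<circ>), one = id\<rparr>"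

text \<open>In what follows \<open>G\<close> is a subgroup of the group of graded automorphisms, with its
  tautological (hence faithful) action.\<close>

type_synonym ('v, 'k) aut_monoid = "(('v, 'k) mpoly \<Rightarrow> ('v, 'k) mpoly) monoid"

definition fixed_by :: "('v, 'k) aut_monoid \<Rightarrow> ('v, 'k::comm_ring_1) mpoly \<Rightarrow> bool" where
  "fixed_by G f \<longleftrightarrow> (\<forall>g\<in>carrier G. g f = f)"

definition invariant_ring ::
    "('v, 'k) aut_monoid \<Rightarrow> ('v, 'k::comm_ring_1) mpoly ring" where
  "invariant_ring G =
     \<lparr>carrier = {f. fixed_by G f}, monoid.mult = (*), one = 1, zero = 0, add = (+)\<rparr>"

abbreviation invariants :: "('v, 'k) aut_monoid \<Rightarrow> ('v, 'k::comm_ring_1) mpoly set" where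
  "invariants G \<equiv> carrier (invariant_ring G)"

definition positive_invariants ::
    "('v, 'k) aut_monoid \<Rightarrow> ('v, 'k::comm_ring_1) mpoly set" where
  "positive_invariants G = {f \<in> invariants G. \<forall>m\<in>Poly_Mapping.keys f. 0 < mdeg m}"

definition positive_invariants_squared ::
    "('v, 'k) aut_monoid \<Rightarrow> ('v, 'k::comm_ring_1) mpoly set" where
  "positive_invariants_squared G =
     ideal_prod (invariant_ring G) (positive_invariants G) (positive_invariants G)"

definition linear_form :: "('v, 'k::comm_ring_1) mpoly \<Rightarrow> bool" where
  "linear_form l \<longleftrightarrow> homogeneous 1 l"

abbreviation orbit_of ::
    "('v, 'k) aut_monoid \<Rightarrow> ('v, 'k::comm_ring_1) mpoly \<Rightarrow> ('v, 'k) mpoly set" where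
  "orbit_of G l \<equiv> orbit G (\<lambda>g. g) l"

definition orbit_norm ::
    "('v, 'k) aut_monoid \<Rightarrow> ('v, 'k::comm_ring_1) mpoly \<Rightarrow> ('v, 'k) mpoly" where
  "orbit_norm G l = (\<Prod>m\<in>orbit_of G l. m)"

definition nonlinear_orbit_norms ::
    "('v, 'k) aut_monoid \<Rightarrow> ('v, 'k::comm_ring_1) mpoly set" where
  "nonlinear_orbit_norms G = {orbit_norm G l | l. linear_form l \<and> \<not> fixed_by G l}"


section \<open>Wehlau's norm conjecture\<close>

definition norm_prediction :: "('v, 'k::field) aut_monoid \<Rightarrow> bool" where
  "norm_prediction G \<longleftrightarrow>
     (\<exists>B. homogeneous_minimal_generating_set (invariants G) B \<and>
          B \<inter> nonlinear_orbit_norms G \<noteq> {})"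

text \<open>A finite group of graded automorphisms whose order is divisible by the characteristic
  of the field; as the order is positive, the characteristic is then positive too.\<close>

definition modular_group :: "('v, 'k::field) aut_monoid \<Rightarrow> bool" where
  "modular_group G \<longleftrightarrow>
     (\<exists>H. subgroup H graded_aut_group \<and> G = graded_aut_group\<lparr>carrier := H\<rparr>) \<and>
     finite (carrier G) \<and> CHAR('k) dvd order G"

text \<open>HOL cannot quantify over types inside a formula, so the conjectures are stated for a
  given finite set of variables and a given field; the conjectures proper assert all
  instances, and are refuted by the failure of a single one.\<close>

definition wehlau_norm_conjecture_unrestricted ::
    "'v::finite itself \<Rightarrow> 'k::field itself \<Rightarrow> bool" where
  "wehlau_norm_conjecture_unrestricted _ _ \<longleftrightarrow>
     (\<forall>G :: ('v, 'k) aut_monoid. modular_group G \<longrightarrow> norm_prediction G)"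

definition wehlau_norm_conjecture_polynomial ::
    "'v::finite itself \<Rightarrow> 'k::field itself \<Rightarrow> bool" where
  "wehlau_norm_conjecture_polynomial _ _ \<longleftrightarrow>
     (\<forall>G :: ('v, 'k) aut_monoid.
        modular_group G \<and> polynomial_algebra (invariants G) \<longrightarrow> norm_prediction G)"


section \<open>The group of the counterexample\<close>

datatype xy_var = X1 | X2 | Y1 | Y2

instance xy_var :: finite
proof
  have "(UNIV :: xy_var set) \<subseteq> {X1, X2, Y1, Y2}"
    using xy_var.exhaust by blast
  then show "finite (UNIV :: xy_var set)"
    by (rule finite_subset) simp
qed

type_synonym S = "(xy_var, f8) mpoly"

definition x1 :: S where "x1 = var X1"
definition x2 :: S where "x2 = var X2"
definition y1 :: S where "y1 = var Y1"
definition y2 :: S where "y2 = var Y2"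

text \<open>\<open>fix_x p q\<close> is the k-algebra endomorphism of \<open>S\<close> fixing x1, x2 and sending
  y1 to \<open>p\<close> and y2 to \<open>q\<close>.\<close>

definition fix_x :: "S \<Rightarrow> S \<Rightarrow> S \<Rightarrow> S" where
  "fix_x p q = poly_eval (\<lambda>v. case v of X1 \<Rightarrow> x1 | X2 \<Rightarrow> x2 | Y1 \<Rightarrow> p | Y2 \<Rightarrow> q)"

definition \<sigma>1 :: "S \<Rightarrow> S" where
  "\<sigma>1 = fix_x (y1 + x1) y2"

definition \<sigma>2 :: "S \<Rightarrow> S" where
  "\<sigma>2 = fix_x y1 (y2 + x2)"

definition \<sigma>3 :: "S \<Rightarrow> S" where
  "\<sigma>3 = fix_x (y1 + const (1 + \<alpha>^2) * x1 + x2)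
              (y2 + const \<alpha> * x1 + const (\<alpha>^2) * x2)"

definition \<sigma>4 :: "S \<Rightarrow> S" where
  "\<sigma>4 = fix_x (y1 + const (1 + \<alpha>^2) * x1 + const (\<alpha>^2) * x2)
              (y2 + const (1 + \<alpha>^2) * x1 + const (\<alpha>^2) * x2)"

end

theory Submission
  imports Defs
begin

text \<open>
  The elements of G are translations of (y1, y2) by pairs of linear forms in x1, x2.  The
  invariants of \<sigma>1 and \<sigma>2 are generated over k[x1, x2] by N1 = y1^2 + x1 y1 and
  N2 = y2^2 + x2 y2, and \<sigma>3, \<sigma>4 act on (N1, N2) again by translations.  Two such
  translations with independent translation vectors cut the free module with basis
  1, y, z, yz over the fixed subalgebra down to that subalgebra; applied twice, this shows that
  x1, x2 and two forms h1, h2 of degree 4 with leading terms y1^4, y2^4 generate the invariants.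
  They are algebraically independent, as one sees from terms of lowest degree in x1, x2.
  A nonfixed linear form has stabilizer of order at most 2, so its orbit norm has degree
  8 or 16, too large for a generator.
\<close>

text \<open>To make \<open>h1\<close> and \<open>h2\<close> invariant, the squares of the shifts of
  \<open>N1\<close> and \<open>N2\<close> must be linear combinations of these shifts, with the same
  coefficients for \<sigma>3 and \<sigma>4. This is a linear system whose determinant is a nonzero
  quartic in \<open>x1\<close>, \<open>x2\<close>, so Cramer's rule gives each coefficient as a
  sextic divided by a quartic. For the translations at hand these quotients are polynomials, which
  makes generators of degree 4 possible. The orbit sizes rest on a second property of the same
  constants: for every nonzero \<open>(c, e)\<close> the group moves \<open>c * y1 + e * y2\<close>
  through an F_2-space of dimension at least 3. It is checked by enumeration. The claim on generator
  degrees concerns all homogeneous minimal generating sets, so exhibiting one does not settle it.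
  The isomorphism \<open>poly_eval gen\<close> moves the question to a polynomial ring with weights
  1, 1, 4, 4, where linear coefficients can be compared. Norms are excluded from minimal generating
  sets by these degrees; their membership in the square of the ideal is a separate argument on
  monomials in the generators.\<close>

abbreviation "single \<equiv> Poly_Mapping.single"
abbreviation "lookup \<equiv> Poly_Mapping.lookup"
abbreviation "keys \<equiv> Poly_Mapping.keys"

text \<open>The order on the variables only serves to obtain the integral domain instance of
  \<^typ>\<open>S\<close>, which the library provides for linearly ordered monomials.\<close>

instantiation xy_var :: linorder
begin

primrec xy_index :: "xy_var \<Rightarrow> nat" where
  "xy_index X1 = 0" | "xy_index X2 = 1" | "xy_index Y1 = 2" | "xy_index Y2 = 3"

definition less_eq_xy_var :: "xy_var \<Rightarrow> xy_var \<Rightarrow> bool" where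
  "v \<le> w \<longleftrightarrow> xy_index v \<le> xy_index w"

definition less_xy_var :: "xy_var \<Rightarrow> xy_var \<Rightarrow> bool" where
  "v < w \<longleftrightarrow> xy_index v < xy_index w"

instance
proof
  fix v w :: xy_var
  show "v = w" if "v \<le> w" "w \<le> v"
    using that by (cases v; cases w) (simp_all add: less_eq_xy_var_def)
qed (auto simp: less_eq_xy_var_def less_xy_var_def)

end

section \<open>Polynomials, subalgebras and evaluation\<close>

lemma const_0 [simp]: "const 0 = 0"
  and const_1 [simp]: "const 1 = 1"
  and const_add: "const (a + b) = const a + const b"
  and const_mult: "const (a * b) = const a * const b"
  by (simp_all add: const_def single_add mult_single)

lemma lookup_const: "lookup (const c) m = (c when m = 0)"
  by (simp add: const_def lookup_single when_def)

lemma const_mult_single: "const c * single m d = single m (c * d)"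
  by (simp add: const_def mult_single)

lemma lookup_const_mult: "lookup (const c * f) m = c * lookup f m"
  unfolding const_def mult_map_scale_conv_mult [symmetric]
  by (simp add: Poly_Mapping.map.rep_eq when_def)

lemma var_power: "var v ^ n = single (single v n) 1"
  by (induction n) (simp_all add: var_def mult_single single_add [symmetric])

lemma single_prod:
  "(\<Prod>i\<in>I. single (f i) (1 :: 'k::comm_ring_1)) = single (\<Sum>i\<in>I. f i) 1"
  for f :: "'i \<Rightarrow> 'm::comm_monoid_add"
  by (induction I rule: infinite_finite_induct) (simp_all add: mult_single)

lemma poly_mapping_sum_superset:
  "finite M \<Longrightarrow> keys p \<subseteq> M \<Longrightarrow> (\<Sum>m\<in>M. single m (lookup p m)) = p"
  by (rule poly_mapping_eqI)
    (auto simp: lookup_sum lookup_single when_def in_keys_iff subset_iff)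

lemma poly_mapping_sum_keys: "(\<Sum>m\<in>keys p. single m (lookup p m)) = p"
  by (simp add: poly_mapping_sum_superset)

lemma single_eq_const_mult_vars:
  "single m c = const c * (\<Prod>v\<in>keys m. var v ^ lookup m v)"
  by (simp add: var_power single_prod poly_mapping_sum_keys const_mult_single)

lemma subalgebraD:
  assumes "subalgebra A"
  shows "const c \<in> A" "f \<in> A \<Longrightarrow> g \<in> A \<Longrightarrow> f + g \<in> A" "f \<in> A \<Longrightarrow> g \<in> A \<Longrightarrow> f * g \<in> A"
  using assms unfolding subalgebra_def by blast+

lemma subalgebra_0: "subalgebra A \<Longrightarrow> 0 \<in> A"
  and subalgebra_1: "subalgebra A \<Longrightarrow> 1 \<in> A"
  using subalgebraD(1)[of A 0] subalgebraD(1)[of A 1] by simp_all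

lemma subalgebra_uminus: "subalgebra A \<Longrightarrow> f \<in> A \<Longrightarrow> - f \<in> A"
  using subalgebraD(3)[of A "const (- 1)" f] subalgebraD(1)[of A "- 1"]
  by (simp add: const_def single_uminus)

lemma subalgebra_diff: "subalgebra A \<Longrightarrow> f \<in> A \<Longrightarrow> g \<in> A \<Longrightarrow> f - g \<in> A"
  using subalgebraD(2)[of A f "- g"] subalgebra_uminus[of A g] by simp

lemma subalgebra_sum: "subalgebra A \<Longrightarrow> (\<And>i. i \<in> I \<Longrightarrow> f i \<in> A) \<Longrightarrow> sum f I \<in> A"
  by (induction I rule: infinite_finite_induct) (simp_all add: subalgebra_0 subalgebraD)

lemma subalgebra_prod: "subalgebra A \<Longrightarrow> (\<And>i. i \<in> I \<Longrightarrow> f i \<in> A) \<Longrightarrow> prod f I \<in> A"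
  by (induction I rule: infinite_finite_induct) (simp_all add: subalgebra_1 subalgebraD)

lemma subalgebra_power: "subalgebra A \<Longrightarrow> f \<in> A \<Longrightarrow> f ^ n \<in> A"
  by (induction n) (simp_all add: subalgebra_1 subalgebraD)

lemma subalgebra_hull: "subalgebra (subalgebra hull B)"
  by (rule hull_in) (auto simp: subalgebra_def)

lemma in_subalgebra_if_indets:
  assumes A: "subalgebra A" and vars: "\<And>v. v \<in> indets f \<Longrightarrow> var v \<in> A"
  shows "f \<in> A"
proof -
  have "single m (lookup f m) \<in> A" if "m \<in> keys f" for m
    unfolding single_eq_const_mult_vars
    using that vars unfolding indets_def
    by (intro subalgebraD[OF A] subalgebra_prod[OF A] subalgebra_power[OF A]) auto
  then have "(\<Sum>m\<in>keys f. single m (lookup f m)) \<in> A"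
    by (rule subalgebra_sum[OF A])
  then show ?thesis
    by (simp add: poly_mapping_sum_keys)
qed

lemma subalgebra_indets: "subalgebra {f :: ('v, 'k::comm_ring_1) mpoly. indets f \<subseteq> V}"
  unfolding subalgebra_def
proof (intro conjI ballI)
  show "range const \<subseteq> {f :: ('v, 'k) mpoly. indets f \<subseteq> V}"
    by (auto simp: indets_def const_def split: if_splits)
next
  fix f g :: "('v, 'k) mpoly"
  assume "f \<in> {f. indets f \<subseteq> V}" "g \<in> {f. indets f \<subseteq> V}"
  then have f: "\<And>m. m \<in> keys f \<Longrightarrow> keys m \<subseteq> V" and g: "\<And>m. m \<in> keys g \<Longrightarrow> keys m \<subseteq> V"
    by (auto simp: indets_def)
  have "keys m \<subseteq> V" if "m \<in> keys (f + g)" for m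
    using that Poly_Mapping.keys_add[of f g] f[of m] g[of m] by (meson Un_iff subsetD)
  then show "f + g \<in> {f. indets f \<subseteq> V}"
    by (simp add: indets_def UN_least)
  have "keys m \<subseteq> V" if m: "m \<in> keys (f * g)" for m
  proof -
    obtain a b where "a \<in> keys f" "b \<in> keys g" "m = a + b"
      using m keys_mult[of f g] by blast
    then show ?thesis
      using f[of a] g[of b] Poly_Mapping.keys_add[of a b] by (simp add: subset_trans[OF _ Un_least])
  qed
  then show "f * g \<in> {f. indets f \<subseteq> V}"
    by (simp add: indets_def UN_least)
qed

lemma indets_var: "indets (var v :: ('v, 'k::comm_ring_1) mpoly) = {v}"
  by (simp add: indets_def var_def)

lemma in_subalgebra_if_vars: "subalgebra A \<Longrightarrow> (\<And>v. var v \<in> A) \<Longrightarrow> f \<in> A"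
  by (rule in_subalgebra_if_indets)

text \<open>Source and target may have different variables, and degrees need not be preserved. This
  covers the renaming of variables as well as evaluation at generators of degree 4.\<close>

definition algebra_hom :: "(('u, 'k) mpoly \<Rightarrow> ('v, 'k::comm_ring_1) mpoly) \<Rightarrow> bool" where
  "algebra_hom \<phi> \<longleftrightarrow>
     (\<forall>f g. \<phi> (f + g) = \<phi> f + \<phi> g) \<and> (\<forall>f g. \<phi> (f * g) = \<phi> f * \<phi> g) \<and> (\<forall>c. \<phi> (const c) = const c)"

context
  fixes \<phi> :: "('u, 'k) mpoly \<Rightarrow> ('v, 'k::comm_ring_1) mpoly"
  assumes \<phi>: "algebra_hom \<phi>"
begin

lemma hom_add: "\<phi> (f + g) = \<phi> f + \<phi> g"
  and hom_mult: "\<phi> (f * g) = \<phi> f * \<phi> g"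
  and hom_const: "\<phi> (const c) = const c"
  using \<phi> by (auto simp: algebra_hom_def)

lemma hom_0: "\<phi> 0 = 0"
  and hom_1: "\<phi> 1 = 1"
  using hom_const[of 0] hom_const[of 1] by simp_all

lemma hom_uminus: "\<phi> (- f) = - \<phi> f"
  using hom_add[of f "- f"] by (simp add: hom_0 eq_neg_iff_add_eq_0 add.commute)

lemma hom_diff: "\<phi> (f - g) = \<phi> f - \<phi> g"
  using hom_add[of f "- g"] by (simp add: hom_uminus)

lemma hom_prod: "\<phi> (prod f I) = (\<Prod>i\<in>I. \<phi> (f i))"
  by (induction I rule: infinite_finite_induct) (simp_all add: hom_1 hom_mult)

lemma hom_power: "\<phi> (f ^ n) = \<phi> f ^ n"
  by (induction n) (simp_all add: hom_1 hom_mult)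

lemma subalgebra_image: "subalgebra A \<Longrightarrow> subalgebra (\<phi> ` A)"
  unfolding subalgebra_def
  by (auto simp: hom_add [symmetric] hom_mult [symmetric])
    (metis hom_const imageI range_subsetD)

lemma subalgebra_vimage: "subalgebra A \<Longrightarrow> subalgebra (\<phi> -` A)"
  by (auto simp: subalgebra_def hom_add hom_mult hom_const)

text \<open>Images and preimages of subalgebras are subalgebras. Through this equation, generating
  sets are transported along an isomorphism.\<close>

lemma hull_image: "subalgebra hull (\<phi> ` B) = \<phi> ` (subalgebra hull B)"
proof
  show "subalgebra hull (\<phi> ` B) \<subseteq> \<phi> ` (subalgebra hull B)"
    by (intro hull_minimal image_mono hull_subset subalgebra_image subalgebra_hull)
  have "subalgebra hull B \<subseteq> \<phi> -` (subalgebra hull (\<phi> ` B))"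
    by (intro hull_minimal subalgebra_vimage subalgebra_hull) (auto intro: hull_inc)
  then show "\<phi> ` (subalgebra hull B) \<subseteq> subalgebra hull (\<phi> ` B)" by blast
qed

text \<open>The equalizer of two homomorphisms is a subalgebra. Only the variables occurring in
  \<open>f\<close> are compared, because the renaming maps used later agree only on some of the
  variables.\<close>

lemma hom_ext:
  assumes \<psi>: "algebra_hom \<psi>" and eq: "\<And>v. v \<in> indets f \<Longrightarrow> \<phi> (var v) = \<psi> (var v)"
  shows "\<phi> f = \<psi> f"
proof -
  have "subalgebra {f. \<phi> f = \<psi> f}"
    using \<phi> \<psi> by (auto simp: subalgebra_def algebra_hom_def)
  from in_subalgebra_if_indets[OF this] eq show ?thesis by blast
qed

end

lemma algebra_hom_comp: "algebra_hom \<phi> \<Longrightarrow> algebra_hom \<psi> \<Longrightarrow> algebra_hom (\<phi> \<circ> \<psi>)"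
  by (simp add: algebra_hom_def)

lemma algebra_hom_id: "algebra_hom id"
  by (simp add: algebra_hom_def)

section \<open>Evaluation homomorphisms\<close>

definition monom_eval :: "('i \<Rightarrow> 'a::comm_monoid_mult) \<Rightarrow> ('i \<Rightarrow>\<^sub>0 nat) \<Rightarrow> 'a" where
  "monom_eval s m = (\<Prod>i\<in>keys m. s i ^ lookup m i)"

lemma monom_eval_superset:
  "finite I \<Longrightarrow> keys m \<subseteq> I \<Longrightarrow> monom_eval s m = (\<Prod>i\<in>I. s i ^ lookup m i)"
  unfolding monom_eval_def by (rule prod.mono_neutral_left) (auto simp: in_keys_iff)

lemma monom_eval_add: "monom_eval s (m + n) = monom_eval s m * monom_eval s n"
proof -
  define I where "I = keys m \<union> keys n"
  have "finite I" "keys m \<subseteq> I" "keys n \<subseteq> I" "keys (m + n) \<subseteq> I"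
    using Poly_Mapping.keys_add[of m n] by (auto simp: I_def)
  then show ?thesis
    by (simp add: monom_eval_superset[of I] lookup_add power_add prod.distrib)
qed

text \<open>Additivity needs a common index set for \<open>p\<close>, \<open>q\<close> and
  \<open>p + q\<close>, since cancellation can shrink the support of the sum.\<close>

lemma poly_eval_superset:
  "finite M \<Longrightarrow> keys p \<subseteq> M \<Longrightarrow>
     poly_eval s p = (\<Sum>m\<in>M. const (lookup p m) * monom_eval s m)"
  unfolding poly_eval_def monom_eval_def by (rule sum.mono_neutral_left) (auto simp: in_keys_iff)

lemma poly_eval_single: "poly_eval s (single m c) = const c * monom_eval s m"
  by (subst poly_eval_superset[of "{m}"]) auto

lemma poly_eval_const: "poly_eval s (const c) = const c"
  using poly_eval_single[of s 0 c] by (simp add: const_def monom_eval_def mult_single)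

lemma poly_eval_var [simp]: "poly_eval s (var v) = s v"
  by (simp add: var_def poly_eval_single) (simp add: monom_eval_def)

lemma poly_eval_add: "poly_eval s (p + q) = poly_eval s p + poly_eval s q"
proof -
  define M where "M = keys p \<union> keys q"
  have "finite M" "keys p \<subseteq> M" "keys q \<subseteq> M" "keys (p + q) \<subseteq> M"
    using Poly_Mapping.keys_add[of p q] by (auto simp: M_def)
  then show ?thesis
    by (simp add: poly_eval_superset[of M] lookup_add const_add distrib_right sum.distrib)
qed

lemma poly_eval_sum: "poly_eval s (sum f I) = (\<Sum>i\<in>I. poly_eval s (f i))"
  using poly_eval_const[of s 0]
  by (induction I rule: infinite_finite_induct) (simp_all add: poly_eval_add)

lemma mult_eq_sum_keys:
  "p * q = (\<Sum>m\<in>keys p. \<Sum>n\<in>keys q. single (m + n) (lookup p m * lookup q n))"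
  for p q :: "'a::comm_monoid_add \<Rightarrow>\<^sub>0 'k::comm_ring_1"
proof -
  have "p * q = (\<Sum>m\<in>keys p. single m (lookup p m)) *
      (\<Sum>n\<in>keys q. single n (lookup q n))"
    by (simp add: poly_mapping_sum_keys)
  then show ?thesis
    by (simp add: sum_product mult_single)
qed

lemma poly_eval_mult: "poly_eval s (p * q) = poly_eval s p * poly_eval s q"
proof -
  have "poly_eval s (p * q) = (\<Sum>m\<in>keys p. \<Sum>n\<in>keys q.
      (const (lookup p m) * monom_eval s m) * (const (lookup q n) * monom_eval s n))"
    by (simp add: mult_eq_sum_keys[of p q] poly_eval_sum poly_eval_single const_mult
        monom_eval_add mult_ac)
  also have "\<dots> = poly_eval s p * poly_eval s q"
    by (simp add: sum_product [symmetric] poly_eval_superset[OF finite_keys order_refl])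
  finally show ?thesis .
qed

lemma poly_eval_hom: "algebra_hom (poly_eval s)"
  by (simp add: algebra_hom_def poly_eval_add poly_eval_mult poly_eval_const)

lemmas poly_eval_diff = hom_diff[OF poly_eval_hom]

lemma hom_eq_poly_eval: "algebra_hom \<phi> \<Longrightarrow> \<phi> f = poly_eval (\<lambda>v. \<phi> (var v)) f"
  by (rule hom_ext[OF _ poly_eval_hom]) simp_all

lemma range_poly_eval:
  fixes s :: "'i \<Rightarrow> ('v, 'k::comm_ring_1) mpoly"
  shows "range (poly_eval s) = subalgebra hull (range s)"
proof -
  have "f \<in> subalgebra hull (range var)" for f :: "('i, 'k) mpoly"
    by (rule in_subalgebra_if_vars[OF subalgebra_hull]) (rule hull_inc[OF rangeI])
  then have "subalgebra hull (range var) = (UNIV :: ('i, 'k) mpoly set)" by blast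
  moreover have "range s = poly_eval s ` range var"
    by (auto simp: image_image)
  ultimately show ?thesis
    by (metis hull_image poly_eval_hom)
qed

lemma inj_var: "inj (var :: 'v \<Rightarrow> ('v, 'k::comm_ring_1) mpoly)"
proof (rule injI)
  fix v w :: 'v
  assume "var v = (var w :: ('v, 'k) mpoly)"
  then have "lookup (var w :: ('v, 'k) mpoly) (single v 1) = 1"
    by (metis lookup_single_eq var_def)
  then have "single w (1::nat) = single v 1"
    by (auto simp: var_def lookup_single when_def split: if_splits)
  then show "v = w"
    by (metis keys_single singleton_inject zero_neq_one)
qed

text \<open>In \<open>polynomial_algebra\<close> the generators themselves serve as variables.
  Injectivity of the evaluation makes \<open>s\<close> injective, so the variables can be renamed
  back and forth along \<open>s\<close>.\<close>

lemma polynomial_algebra_range: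
  fixes s :: "'i::finite \<Rightarrow> ('v, 'k::comm_ring_1) mpoly"
  assumes inj: "inj (poly_eval s)"
  shows "polynomial_algebra (range (poly_eval s))"
  unfolding polynomial_algebra_def
proof (intro exI conjI)
  have s: "inj s"
  proof (rule injI)
    fix i j assume "s i = s j"
    then have "poly_eval s (var i) = poly_eval s (var j)" by simp
    with inj have "var i = (var j :: ('i, 'k) mpoly)" by (rule injD)
    then show "i = j" by (rule injD[OF inj_var])
  qed
  \<comment> \<open>Outside \<open>range s\<close> the value of \<open>inv_into\<close> is
    arbitrary, so \<open>e\<close> undoes \<open>r\<close> only on polynomials with variables in
    \<open>range s\<close>.\<close>
  define r :: "(('v, 'k) mpoly, 'k) mpoly \<Rightarrow> ('i, 'k) mpoly"
    where "r = poly_eval (\<lambda>b. var (inv_into UNIV s b))"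
  define e :: "('i, 'k) mpoly \<Rightarrow> (('v, 'k) mpoly, 'k) mpoly"
    where "e = poly_eval (\<lambda>i. var (s i))"
  have er: "e (r p) = p" if "indets p \<subseteq> range s" for p
  proof -
    have "(e \<circ> r) p = id p"
      using that s by (intro hom_ext[of "e \<circ> r" id p] algebra_hom_comp algebra_hom_id)
        (auto simp: e_def r_def poly_eval_hom)
    then show ?thesis by simp
  qed
  have eval_e: "poly_eval (\<lambda>b. b) (e q) = poly_eval s q" for q
  proof -
    have "(poly_eval (\<lambda>b. b) \<circ> e) q = poly_eval s q"
      by (intro hom_ext[of "poly_eval (\<lambda>b. b) \<circ> e" "poly_eval s" q] algebra_hom_comp)
        (auto simp: e_def poly_eval_hom)
    then show ?thesis by simp
  qed
  have ind: "indets (e q) \<subseteq> range s" for q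
  proof -
    note A = subalgebra_indets[of "range s"]
    have "(var b :: (('v, 'k) mpoly, 'k) mpoly) \<in> {p. indets p \<subseteq> range s}" if "b \<in> range s" for b
      using that by (simp add: indets_var)
    then have "e ` UNIV \<subseteq> {p. indets p \<subseteq> range s}"
      unfolding e_def range_poly_eval by (intro hull_minimal A) auto
    then show ?thesis by blast
  qed
  show "bij_betw (poly_eval (\<lambda>b. b)) {p. indets p \<subseteq> range s} (range (poly_eval s))"
  proof (rule bij_betw_imageI)
    show "inj_on (poly_eval (\<lambda>b. b)) {p. indets p \<subseteq> range s}"
    proof (rule inj_onI)
      fix p q
      assume p: "p \<in> {p. indets p \<subseteq> range s}" and q: "q \<in> {p. indets p \<subseteq> range s}"
        and eq: "poly_eval (\<lambda>b. b) p = poly_eval (\<lambda>b. b) q"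
      have ep: "e (r p) = p" and eq': "e (r q) = q"
        using p q by (simp_all add: er)
      have "poly_eval s (r p) = poly_eval s (r q)"
        using eq eval_e[of "r p"] eval_e[of "r q"] by (simp add: ep eq')
      with inj have "r p = r q" by (rule injD)
      with ep eq' show "p = q" by metis
    qed
    show "poly_eval (\<lambda>b. b) ` {p. indets p \<subseteq> range s} = range (poly_eval s)" (is "?l = ?r")
    proof
      show "?l \<subseteq> ?r"
      proof clarify
        fix p :: "(('v, 'k) mpoly, 'k) mpoly"
        assume "indets p \<subseteq> range s"
        then show "poly_eval (\<lambda>b. b) p \<in> ?r"
          using eval_e[of "r p"] er[of p] by simp
      qed
      show "?r \<subseteq> ?l"
      proof clarify
        fix q show "poly_eval s q \<in> ?l"
          by (rule image_eqI[where x = "e q"]) (simp_all add: eval_e ind)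
      qed
    qed
  qed
qed simp

section \<open>Weights\<close>

text \<open>Three gradings are instances: the standard degree (all weights 1), \<open>degs\<close>
  on the ring presenting the invariants, and \<open>xdeg\<close>, which sees only \<open>x1\<close>
  and \<open>x2\<close>.\<close>

definition weight :: "('v \<Rightarrow> nat) \<Rightarrow> ('v \<Rightarrow>\<^sub>0 nat) \<Rightarrow> nat" where
  "weight w m = (\<Sum>v\<in>keys m. w v * lookup m v)"

lemma mdeg_eq_weight: "mdeg = weight (\<lambda>_. 1)"
  by (simp add: fun_eq_iff mdeg_def weight_def)

lemma weight_superset:
  "finite V \<Longrightarrow> keys m \<subseteq> V \<Longrightarrow> weight w m = (\<Sum>v\<in>V. w v * lookup m v)"
  unfolding weight_def by (rule sum.mono_neutral_left) (auto simp: in_keys_iff)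

lemma weight_add: "weight w (m + n) = weight w m + weight w n"
proof -
  define V where "V = keys m \<union> keys n"
  have "finite V" "keys m \<subseteq> V" "keys n \<subseteq> V" "keys (m + n) \<subseteq> V"
    using Poly_Mapping.keys_add[of m n] by (auto simp: V_def)
  then show ?thesis
    by (simp add: weight_superset[of V] lookup_add distrib_left sum.distrib)
qed

lemma weight_single: "weight w (single v n) = w v * n"
  by (cases "n = 0") (simp_all add: weight_def)

lemma weight_0 [simp]: "weight w 0 = 0"
  by (simp add: weight_def)

definition whomogeneous :: "('v \<Rightarrow> nat) \<Rightarrow> nat \<Rightarrow> ('v, 'k::comm_ring_1) mpoly \<Rightarrow> bool" where
  "whomogeneous w d f \<longleftrightarrow> (\<forall>m\<in>keys f. weight w m = d)"

lemma homogeneous_eq_whomogeneous: "homogeneous = whomogeneous (\<lambda>_. 1)"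
  by (simp add: fun_eq_iff homogeneous_def whomogeneous_def mdeg_eq_weight)

lemma whomogeneous_single: "weight w m = d \<Longrightarrow> whomogeneous w d (single m c)"
  by (simp add: whomogeneous_def)

lemma whomogeneous_0 [simp]: "whomogeneous w d 0"
  by (simp add: whomogeneous_def)

lemma whomogeneous_const: "whomogeneous w 0 (const c)"
  by (simp add: const_def whomogeneous_single)

lemma whomogeneous_var: "whomogeneous w (w v) (var v)"
  by (simp add: var_def whomogeneous_single weight_single)

lemma whomogeneous_add:
  assumes "whomogeneous w d f" "whomogeneous w d g"
  shows "whomogeneous w d (f + g)"
  unfolding whomogeneous_def
proof
  fix m assume "m \<in> keys (f + g)"
  then have "m \<in> keys f \<or> m \<in> keys g"
    using Poly_Mapping.keys_add[of f g] by blast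
  with assms show "weight w m = d" by (auto simp: whomogeneous_def)
qed

lemma whomogeneous_mult:
  assumes "whomogeneous w d f" "whomogeneous w e g"
  shows "whomogeneous w (d + e) (f * g)"
  unfolding whomogeneous_def
proof
  fix m assume "m \<in> keys (f * g)"
  then obtain a b where "a \<in> keys f" "b \<in> keys g" "m = a + b"
    using keys_mult[of f g] by blast
  with assms show "weight w m = d + e" by (auto simp: whomogeneous_def weight_add)
qed

lemma whomogeneous_const_mult: "whomogeneous w d f \<Longrightarrow> whomogeneous w d (const c * f)"
  using whomogeneous_mult[OF whomogeneous_const] by fastforce

lemma whomogeneous_sum:
  "(\<And>i. i \<in> I \<Longrightarrow> whomogeneous w d (f i)) \<Longrightarrow> whomogeneous w d (sum f I)"
  by (induction I rule: infinite_finite_induct) (simp_all add: whomogeneous_add)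

lemma whomogeneous_1: "whomogeneous w 0 1"
  using whomogeneous_const[of w 1] by simp

lemma whomogeneous_prod:
  "(\<And>i. i \<in> I \<Longrightarrow> whomogeneous w (d i) (f i)) \<Longrightarrow> whomogeneous w (sum d I) (prod f I)"
  by (induction I rule: infinite_finite_induct) (simp_all add: whomogeneous_1 whomogeneous_mult)

lemma whomogeneous_power: "whomogeneous w d f \<Longrightarrow> whomogeneous w (d * n) (f ^ n)"
  using whomogeneous_prod[of "{..<n}" w "\<lambda>_. d" "\<lambda>_. f"] by (simp add: mult.commute)

lemma whomogeneous_monom_eval:
  assumes "\<And>v. whomogeneous w (d v) (s v)"
  shows "whomogeneous w (weight d m) (monom_eval s m)"
  unfolding monom_eval_def weight_def
  by (intro whomogeneous_prod whomogeneous_power assms)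

lemma whomogeneous_poly_eval:
  assumes s: "\<And>v. whomogeneous w (d v) (s v)" and f: "whomogeneous d e f"
  shows "whomogeneous w e (poly_eval s f)"
  unfolding poly_eval_superset[OF finite_keys order_refl]
proof (rule whomogeneous_sum)
  fix m assume "m \<in> keys f"
  then have "weight d m = e"
    using f by (simp add: whomogeneous_def)
  with whomogeneous_monom_eval[of w d s m, OF s]
  show "whomogeneous w e (const (lookup f m) * monom_eval s m)"
    by (simp add: whomogeneous_const_mult)
qed

lemma whomogeneous_unique:
  "whomogeneous w d f \<Longrightarrow> whomogeneous w e f \<Longrightarrow> f \<noteq> 0 \<Longrightarrow> d = e"
  unfolding whomogeneous_def by (metis all_not_in_conv keys_eq_empty)

lemma total_degree_eq:
  assumes f: "homogeneous d f" "f \<noteq> 0"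
  shows "total_degree f = d"
proof -
  obtain m where "m \<in> keys f"
    using f by (metis all_not_in_conv keys_eq_empty)
  then have "mdeg ` keys f = {d}"
    using f by (auto simp: homogeneous_def)
  then show ?thesis by (simp add: total_degree_def)
qed

text \<open>Split \<open>f\<close> into its part \<open>h\<close> of weight \<open>e\<close> and the
  rest \<open>g\<close>. The image of \<open>g\<close> is a difference of two forms of weight
  \<open>e\<close>, yet it is a sum of forms of other weights. So it vanishes, and injectivity gives
  \<open>g = 0\<close>.\<close>

lemma whomogeneous_if_poly_eval:
  fixes s :: "'i \<Rightarrow> ('v, 'k::comm_ring_1) mpoly"
  assumes inj: "inj (poly_eval s)" and s: "\<And>v. whomogeneous w (d v) (s v)"
    and f: "whomogeneous w e (poly_eval s f)"
  shows "whomogeneous d e f"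
proof -
  define g where "g = (\<Sum>m | m \<in> keys f \<and> weight d m \<noteq> e. single m (lookup f m))"
  define h where "h = (\<Sum>m | m \<in> keys f \<and> weight d m = e. single m (lookup f m))"
  have "f = g + h"
    using sum.Int_Diff[of "keys f" "\<lambda>m. single m (lookup f m)" "{m. weight d m \<noteq> e}"]
    by (simp add: g_def h_def poly_mapping_sum_keys Int_def set_diff_eq)
  have "whomogeneous d e h"
    unfolding h_def by (intro whomogeneous_sum whomogeneous_single) simp
  then have "whomogeneous w e (poly_eval s f + const (- 1) * poly_eval s h)"
    using f whomogeneous_poly_eval[of w d s, OF s]
    by (intro whomogeneous_add whomogeneous_const_mult)
  also have "poly_eval s f + const (- 1) * poly_eval s h = poly_eval s g"
    by (simp add: \<open>f = g + h\<close> poly_eval_add const_def single_uminus)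
  finally have hom_g: "weight w n = e" if "n \<in> keys (poly_eval s g)" for n
    using that by (simp add: whomogeneous_def)
  have "weight w n \<noteq> e" if n: "n \<in> keys (poly_eval s g)" for n
  proof -
    have "poly_eval s g = (\<Sum>m | m \<in> keys f \<and> weight d m \<noteq> e. const (lookup f m) * monom_eval s m)"
      unfolding g_def by (simp add: poly_eval_sum poly_eval_single)
    with n obtain m where m: "weight d m \<noteq> e" "n \<in> keys (const (lookup f m) * monom_eval s m)"
      using keys_sum[of "\<lambda>m. const (lookup f m) * monom_eval s m" "{m \<in> keys f. weight d m \<noteq> e}"]
      by auto
    have "whomogeneous w (weight d m) (const (lookup f m) * monom_eval s m)"
      by (intro whomogeneous_const_mult whomogeneous_monom_eval s)
    with m show ?thesis by (simp add: whomogeneous_def)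
  qed
  with hom_g have "keys (poly_eval s g) = {}" by blast
  then have "poly_eval s g = poly_eval s 0"
    by (simp add: hom_0[OF poly_eval_hom])
  with inj have "g = 0" by (rule injD)
  with \<open>f = g + h\<close> \<open>whomogeneous d e h\<close> show ?thesis by simp
qed

text \<open>An ideal of the weight filtration, used as a modulus: remainders are known only to lie
  in it.\<close>

definition weight_ge :: "('v \<Rightarrow> nat) \<Rightarrow> nat \<Rightarrow> ('v, 'k::comm_ring_1) mpoly set" where
  "weight_ge w d = {f. \<forall>m\<in>keys f. d \<le> weight w m}"

lemma weight_ge_add:
  assumes "f \<in> weight_ge w d" "g \<in> weight_ge w d"
  shows "f + g \<in> weight_ge w d"
  unfolding weight_ge_def
proof (rule CollectI, rule ballI)
  fix m assume "m \<in> keys (f + g)"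
  then have "m \<in> keys f \<or> m \<in> keys g"
    using Poly_Mapping.keys_add[of f g] by blast
  with assms show "d \<le> weight w m" by (auto simp: weight_ge_def)
qed

lemma weight_ge_mult:
  assumes "f \<in> weight_ge w d" "g \<in> weight_ge w e"
  shows "f * g \<in> weight_ge w (d + e)"
  unfolding weight_ge_def
proof (rule CollectI, rule ballI)
  fix m assume "m \<in> keys (f * g)"
  then obtain a b where "a \<in> keys f" "b \<in> keys g" "m = a + b"
    using keys_mult[of f g] by blast
  with assms show "d + e \<le> weight w m" by (auto simp: weight_ge_def weight_add intro: add_mono)
qed

lemma weight_ge_mult_left: "g \<in> weight_ge w d \<Longrightarrow> f * g \<in> weight_ge w d"
  using weight_ge_mult[of f w 0 g d] by (simp add: weight_ge_def)

text \<open>The coefficient of a variable is a partial derivative at the origin, and this is the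
  Leibniz rule there.\<close>

lemma lookup_mult_var:
  "lookup (f * g) (single v 1) =
     lookup f 0 * lookup g (single v 1) + lookup f (single v 1) * lookup g 0"
  for f g :: "('v, 'k::comm_ring_1) mpoly"
proof -
  let ?e = "single v (1 :: nat)"
  have split: "m + n = ?e \<longleftrightarrow> m = 0 \<and> n = ?e \<or> m = ?e \<and> n = 0" for m n :: "'v \<Rightarrow>\<^sub>0 nat"
  proof
    assume mn: "m + n = ?e"
    have add: "lookup m i + lookup n i = lookup ?e i" for i
      by (metis lookup_add mn)
    have others: "lookup m i = 0 \<and> lookup n i = 0" if "i \<noteq> v" for i
      using add[of i] that by (simp add: lookup_single)
    have "lookup m v + lookup n v = 1"
      using add[of v] by simp
    then consider "lookup m v = 0" | "lookup n v = 0" by linarith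
    then show "m = 0 \<and> n = ?e \<or> m = ?e \<and> n = 0"
    proof cases
      case 1
      with others have "m = 0" by (intro poly_mapping_eqI) (metis lookup_zero)
      with mn show ?thesis by simp
    next
      case 2
      with others have "n = 0" by (intro poly_mapping_eqI) (metis lookup_zero)
      with mn show ?thesis by simp
    qed
  qed auto
  have e: "?e \<noteq> 0"
    by (metis lookup_single_eq lookup_zero zero_neq_one)
  \<comment> \<open>Adding \<open>0\<close> and \<open>?e\<close> to both index sets lets the
    Kronecker sums collapse without asking whether these monomials occur in \<open>f\<close> or
    \<open>g\<close>.\<close>
  define M where "M = keys f \<union> {0, ?e}"
  define N where "N = keys g \<union> {0, ?e}"
  have fin: "finite M" "finite N" and M: "0 \<in> M" "?e \<in> M" "keys f \<subseteq> M"
    and N: "0 \<in> N" "?e \<in> N" "keys g \<subseteq> N"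
    by (auto simp: M_def N_def)
  have "f * g = (\<Sum>m\<in>M. single m (lookup f m)) * (\<Sum>n\<in>N. single n (lookup g n))"
    using fin M N by (simp add: poly_mapping_sum_superset)
  also have "\<dots> = (\<Sum>m\<in>M. \<Sum>n\<in>N. single (m + n) (lookup f m * lookup g n))"
    by (simp add: sum_product mult_single)
  finally have "lookup (f * g) ?e = (\<Sum>m\<in>M. \<Sum>n\<in>N. lookup f m * lookup g n when m + n = ?e)"
    by (simp add: lookup_sum lookup_single)
  also have "\<dots> = (\<Sum>m\<in>M. \<Sum>n\<in>N.
      (if n = ?e then (if m = 0 then lookup f 0 * lookup g ?e else 0) else 0) +
      (if n = 0 then (if m = ?e then lookup f ?e * lookup g 0 else 0) else 0))"
  proof (intro sum.cong refl)
    fix m n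
    show "(lookup f m * lookup g n when m + n = ?e) =
      (if n = ?e then (if m = 0 then lookup f 0 * lookup g ?e else 0) else 0) +
      (if n = 0 then (if m = ?e then lookup f ?e * lookup g 0 else 0) else 0)"
      using e by (cases "n = ?e"; cases "n = 0"; cases "m = 0"; cases "m = ?e")
        (simp_all add: split when_def del: One_nat_def)
  qed
  also have "\<dots> = lookup f 0 * lookup g ?e + lookup f ?e * lookup g 0"
    using fin M N by (simp add: sum.distrib del: One_nat_def)
  finally show ?thesis .
qed

text \<open>A tangent vector at the origin kills constants and obeys the Leibniz rule, so its kernel
  is closed under products.\<close>

lemma subalgebra_linear_coeffs:
  fixes a :: "'v \<Rightarrow> 'k::comm_ring_1"
  shows "subalgebra {f. (\<Sum>v\<in>V. a v * lookup f (single v 1)) = 0}"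
  unfolding subalgebra_def
proof (intro conjI ballI subsetI CollectI)
  fix f :: "('v, 'k) mpoly" assume "f \<in> range const"
  then obtain c where c: "f = const c" by blast
  have "lookup f (single v (1 :: nat)) = 0" for v
    unfolding c lookup_const
    by (metis lookup_single_eq lookup_zero when_simps(2) zero_neq_one)
  then show "(\<Sum>v\<in>V. a v * lookup f (single v 1)) = 0" by simp
next
  fix f g :: "('v, 'k) mpoly"
  assume "f \<in> {f. (\<Sum>v\<in>V. a v * lookup f (single v 1)) = 0}"
    and "g \<in> {f. (\<Sum>v\<in>V. a v * lookup f (single v 1)) = 0}"
  then have f: "(\<Sum>v\<in>V. a v * lookup f (single v 1)) = 0"
    and g: "(\<Sum>v\<in>V. a v * lookup g (single v 1)) = 0"
    by simp_all
  from f g show "(\<Sum>v\<in>V. a v * lookup (f + g) (single v 1)) = 0"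
    by (simp add: lookup_add distrib_left sum.distrib)
  have "(\<Sum>v\<in>V. a v * lookup (f * g) (single v 1)) =
      lookup f 0 * (\<Sum>v\<in>V. a v * lookup g (single v 1)) +
      lookup g 0 * (\<Sum>v\<in>V. a v * lookup f (single v 1))"
    by (simp add: lookup_mult_var sum_distrib_left distrib_left sum.distrib mult_ac
        del: One_nat_def)
  with f g show "(\<Sum>v\<in>V. a v * lookup (f * g) (single v 1)) = 0"
    by simp
qed

section \<open>Invariants of translations\<close>

lemma subalgebra_fixed: "algebra_hom \<tau> \<Longrightarrow> subalgebra {f. \<tau> f = f}"
  by (auto simp: subalgebra_def algebra_hom_def)

text \<open>The two relations rewrite \<open>y * y\<close> and \<open>z * z\<close>, so the
  \<open>A\<close>-span of \<open>1\<close>, \<open>y\<close>, \<open>z\<close>,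
  \<open>y * z\<close> is stable under multiplication by \<open>y\<close> and \<open>z\<close>. Each
  relation may involve both variables, as it does for \<open>N1\<close> and
  \<open>N2\<close>.\<close>

lemma quadratic_span:
  fixes y z :: "('v, 'k::comm_ring_1) mpoly"
  assumes A: "subalgebra A"
    and coeffs: "h \<in> A" "p \<in> A" "q \<in> A" "h' \<in> A" "p' \<in> A" "q' \<in> A"
    and y: "y * y = h + p * y + q * z" and z: "z * z = h' + p' * y + q' * z"
    and f: "f \<in> subalgebra hull (A \<union> {y, z})"
  shows "\<exists>a\<in>A. \<exists>b\<in>A. \<exists>c\<in>A. \<exists>e\<in>A. f = a + b * y + c * z + e * (y * z)"
proof -
  define M where "M = {f. \<exists>a\<in>A. \<exists>b\<in>A. \<exists>c\<in>A. \<exists>e\<in>A. f = a + b * y + c * z + e * (y * z)}"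
  have MI: "f \<in> M" if "a \<in> A" "b \<in> A" "c \<in> A" "e \<in> A" "f = a + b * y + c * z + e * (y * z)"
    for f a b c e
    using that unfolding M_def by blast
  have ME: "\<exists>a b c e. a \<in> A \<and> b \<in> A \<and> c \<in> A \<and> e \<in> A \<and> f = a + b * y + c * z + e * (y * z)"
    if "f \<in> M" for f
    using that unfolding M_def by blast
  note clos = subalgebraD[OF A]
  have M_add: "f + g \<in> M" if "f \<in> M" "g \<in> M" for f g
  proof -
    obtain a b c e where f: "a \<in> A" "b \<in> A" "c \<in> A" "e \<in> A" "f = a + b * y + c * z + e * (y * z)"
      using ME[OF \<open>f \<in> M\<close>] by blast
    obtain a' b' c' e' where g: "a' \<in> A" "b' \<in> A" "c' \<in> A" "e' \<in> A" "g = a' + b' * y + c' * z + e' * (y * z)"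
      using ME[OF \<open>g \<in> M\<close>] by blast
    show ?thesis
      by (rule MI[of "a + a'" "b + b'" "c + c'" "e + e'"])
        (simp_all add: clos f(1-4) g(1-4) f(5) g(5) algebra_simps)
  qed
  have M_scale: "r * f \<in> M" if "r \<in> A" "f \<in> M" for r f
  proof -
    obtain a b c e where f: "a \<in> A" "b \<in> A" "c \<in> A" "e \<in> A" "f = a + b * y + c * z + e * (y * z)"
      using ME[OF \<open>f \<in> M\<close>] by blast
    show ?thesis
      by (rule MI[of "r * a" "r * b" "r * c" "r * e"])
        (simp_all add: clos f(1-4) that f(5) algebra_simps)
  qed
  have M_y: "y * f \<in> M" if "f \<in> M" for f
  proof -
    obtain a b c e where f: "a \<in> A" "b \<in> A" "c \<in> A" "e \<in> A" "f = a + b * y + c * z + e * (y * z)"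
      using ME[OF \<open>f \<in> M\<close>] by blast
    have "y * f = a * y + b * (y * y) + c * (y * z) + e * ((y * y) * z)"
      by (simp add: f(5) algebra_simps)
    also have "\<dots> = a * y + b * (h + p * y + q * z) + c * (y * z) + e * (h * z + p * (y * z) + q * (z * z))"
      by (simp add: y algebra_simps)
    also have "\<dots> = (b * h + e * q * h') + (a + b * p + e * q * p') * y + (b * q + e * h + e * q * q') * z + (c + e * p) * (y * z)"
      by (simp add: z algebra_simps)
    finally show ?thesis
      by (intro MI[of "b * h + e * q * h'" "a + b * p + e * q * p'" "b * q + e * h + e * q * q'" "c + e * p"])
        (simp_all only: clos f(1-4) coeffs)
  qed
  have M_z: "z * f \<in> M" if "f \<in> M" for f
  proof -
    obtain a b c e where f: "a \<in> A" "b \<in> A" "c \<in> A" "e \<in> A" "f = a + b * y + c * z + e * (y * z)"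
      using ME[OF \<open>f \<in> M\<close>] by blast
    have "z * f = a * z + b * (y * z) + c * (z * z) + e * (y * (z * z))"
      by (simp add: f(5) algebra_simps)
    also have "\<dots> = a * z + b * (y * z) + c * (h' + p' * y + q' * z) + e * (h' * y + p' * (y * y) + q' * (y * z))"
      by (simp add: z algebra_simps)
    also have "\<dots> = (c * h' + e * p' * h) + (c * p' + e * h' + e * p' * p) * y + (a + c * q' + e * p' * q) * z + (b + e * q') * (y * z)"
      by (simp add: y algebra_simps)
    finally show ?thesis
      by (intro MI[of "c * h' + e * p' * h" "c * p' + e * h' + e * p' * p" "a + c * q' + e * p' * q" "b + e * q'"])
        (simp_all only: clos f(1-4) coeffs)
  qed
  \<comment> \<open>The multipliers of \<open>M\<close> are visibly closed under products, whereas
    products inside \<open>M\<close> would have to be expanded. Applying a multiplier to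
    \<open>1\<close> brings it back into \<open>M\<close>.\<close>
  have "subalgebra {f. \<forall>g\<in>M. f * g \<in> M}"
    unfolding subalgebra_def
  proof (intro conjI ballI subsetI CollectI)
    fix r g :: "('v, 'k) mpoly"
    assume "r \<in> range const" "g \<in> M"
    then show "r * g \<in> M"
      using clos(1) M_scale by blast
  next
    fix r s g :: "('v, 'k) mpoly"
    assume "r \<in> {f. \<forall>g\<in>M. f * g \<in> M}" "s \<in> {f. \<forall>g\<in>M. f * g \<in> M}" and g: "g \<in> M"
    then have r: "\<And>g. g \<in> M \<Longrightarrow> r * g \<in> M" and s: "\<And>g. g \<in> M \<Longrightarrow> s * g \<in> M"
      by blast+
    show "(r + s) * g \<in> M"
      unfolding distrib_right by (intro M_add r s g)
    show "r * s * g \<in> M"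
      unfolding mult.assoc by (intro r s g)
  qed
  moreover have "A \<union> {y, z} \<subseteq> {f. \<forall>g\<in>M. f * g \<in> M}"
    using M_scale M_y M_z by blast
  ultimately have "f \<in> {f. \<forall>g\<in>M. f * g \<in> M}"
    using f hull_minimal[of "A \<union> {y, z}" "{f. \<forall>g\<in>M. f * g \<in> M}" subalgebra] by blast
  moreover have "1 \<in> M"
    by (rule MI[of 1 0 0 0]) (simp_all add: subalgebra_0[OF A] subalgebra_1[OF A])
  ultimately have "f * 1 \<in> M" by blast
  then show ?thesis unfolding M_def by simp
qed

text \<open>Two translations with linearly independent translation vectors leave nothing but
  the constant term of a bilinear expression: eliminating \<open>b\<close> from the two conditions and
  translating once more gives \<open>e = 0\<close>.\<close>

lemma translation_invariant:
  fixes y z :: "('v::linorder, 'k::idom) mpoly"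
  assumes A: "subalgebra A" and \<tau>: "algebra_hom \<tau>" "algebra_hom \<tau>'"
    and fixed: "\<And>a. a \<in> A \<Longrightarrow> \<tau> a = a" "\<And>a. a \<in> A \<Longrightarrow> \<tau>' a = a"
    and u: "u1 \<in> A" "u2 \<in> A" "\<tau> y = y + u1" "\<tau> z = z + u2"
    and w: "w1 \<in> A" "w2 \<in> A" "\<tau>' y = y + w1" "\<tau>' z = z + w2"
    and det: "u1 * w2 - u2 * w1 \<noteq> 0"
    and coeffs: "a \<in> A" "b \<in> A" "c \<in> A" "e \<in> A"
    and f: "f = a + b * y + c * z + e * (y * z)" "\<tau> f = f" "\<tau>' f = f"
  shows "f = a"
proof -
  define D where "D = u1 * w2 - u2 * w1"
  note clos = subalgebraD[OF A] subalgebra_diff[OF A]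
  have eq1: "b * u1 + c * u2 + e * (y * u2 + z * u1 + u1 * u2) = 0"
    using f(2) by (simp add: f(1) hom_add[OF \<tau>(1)] hom_mult[OF \<tau>(1)] fixed coeffs u algebra_simps)
  have eq2: "b * w1 + c * w2 + e * (y * w2 + z * w1 + w1 * w2) = 0"
    using f(3) by (simp add: f(1) hom_add[OF \<tau>(2)] hom_mult[OF \<tau>(2)] fixed coeffs w algebra_simps)
  \<comment> \<open>In \<open>u1\<close> times the second condition minus \<open>w1\<close> times
    the first, the terms with \<open>z\<close> cancel along with those in \<open>b\<close>. Hence a
    multiple of \<open>y\<close> equals an element of \<open>A\<close>.\<close>
  have eq3: "(D * e) * y = e * u1 * w1 * (u2 - w2) - D * c"
  proof -
    have "(D * e) * y - (e * u1 * w1 * (u2 - w2) - D * c) =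
        (b * w1 + c * w2 + e * (y * w2 + z * w1 + w1 * w2)) * u1 -
        (b * u1 + c * u2 + e * (y * u2 + z * u1 + u1 * u2)) * w1"
      by (simp add: D_def algebra_simps)
    then show ?thesis by (simp add: eq1 eq2)
  qed
  have De: "D * e \<in> A" and rhs: "e * u1 * w1 * (u2 - w2) - D * c \<in> A"
    unfolding D_def by (intro clos coeffs u w)+
  \<comment> \<open>By \<open>eq3\<close> this multiple of \<open>y\<close> is fixed by \<tau>,
    although \<tau> moves \<open>y\<close> by \<open>u1\<close>.\<close>
  have "(D * e) * (y + u1) = (D * e) * y"
  proof -
    have "(D * e) * (y + u1) = \<tau> ((D * e) * y)"
      by (subst hom_mult[OF \<tau>(1)]) (simp only: fixed(1)[OF De] u(3))
    also have "\<dots> = (D * e) * y"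
      unfolding eq3 by (rule fixed(1)[OF rhs])
    finally show ?thesis .
  qed
  then have 1: "D * e * u1 = 0" by (simp add: algebra_simps)
  have "(D * e) * (y + w1) = (D * e) * y"
  proof -
    have "(D * e) * (y + w1) = \<tau>' ((D * e) * y)"
      by (subst hom_mult[OF \<tau>(2)]) (simp only: fixed(2)[OF De] w(3))
    also have "\<dots> = (D * e) * y"
      unfolding eq3 by (rule fixed(2)[OF rhs])
    finally show ?thesis .
  qed
  then have 2: "D * e * w1 = 0" by (simp add: algebra_simps)
  have D: "D \<noteq> 0" using det by (simp add: D_def)
  then have "u1 \<noteq> 0 \<or> w1 \<noteq> 0" by (auto simp: D_def)
  with 1 2 D have e: "e = 0" by auto
  with eq3 D have c: "c = 0" by simp
  have "b * u1 = 0" "b * w1 = 0" using eq1 eq2 by (simp_all add: e c)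
  with \<open>u1 \<noteq> 0 \<or> w1 \<noteq> 0\<close> have "b = 0" by auto
  with e c show ?thesis by (simp add: f(1))
qed

section \<open>Characteristic 2, binary forms and translations\<close>

lemma f8_add_self: "a + a = 0" for a :: f8
  by (cases a) (simp add: zero_f8_def)

lemma add_self [simp]: "f + f = 0" for f :: "('v, f8) mpoly"
proof -
  have "f + f = const (1 + 1) * f"
    unfolding const_add by (simp add: distrib_right)
  then show ?thesis by (simp only: f8_add_self) simp
qed

lemma add_self_left [simp]: "f + (f + g) = g" for f :: "('v, f8) mpoly"
  by (simp flip: add.assoc)

lemma uminus_eq: "- f = f" for f :: "('v, f8) mpoly"
  by (simp add: minus_unique)

lemma diff_eq_add: "f - g = f + g" for f :: "('v, f8) mpoly"
  by (metis diff_conv_add_uminus uminus_eq)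

lemma square_add: "(f + g) ^ 2 = f ^ 2 + g ^ 2" for f :: "('v, f8) mpoly"
  by (simp add: power2_eq_square algebra_simps)

text \<open>Storing forms in \<open>x1\<close>, \<open>x2\<close> as coefficient vectors turns
  polynomial identities into arithmetic in \<open>f8\<close>, which the simplifier
  evaluates.\<close>

definition lin :: "f8 \<Rightarrow> f8 \<Rightarrow> S" where
  "lin a b = const a * x1 + const b * x2"

definition quad :: "f8 \<Rightarrow> f8 \<Rightarrow> f8 \<Rightarrow> S" where
  "quad a b c = const a * x1 ^ 2 + const b * (x1 * x2) + const c * x2 ^ 2"

definition quart :: "f8 \<Rightarrow> f8 \<Rightarrow> f8 \<Rightarrow> f8 \<Rightarrow> f8 \<Rightarrow> S" where
  "quart a b c d e = const a * x1 ^ 4 + const b * (x1 ^ 3 * x2) + const c * (x1 ^ 2 * x2 ^ 2) +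
     const d * (x1 * x2 ^ 3) + const e * x2 ^ 4"

lemma lin_add: "lin a b + lin c d = lin (a + c) (b + d)"
  by (simp add: lin_def const_add algebra_simps)

lemma quad_add: "quad a b c + quad a' b' c' = quad (a + a') (b + b') (c + c')"
  by (simp add: quad_def const_add algebra_simps)

lemma quart_add:
  "quart a b c d e + quart a' b' c' d' e' = quart (a + a') (b + b') (c + c') (d + d') (e + e')"
  by (simp add: quart_def const_add algebra_simps)

lemma lin_mult: "lin a b * lin c d = quad (a * c) (a * d + b * c) (b * d)"
  by (simp add: lin_def quad_def const_add const_mult power2_eq_square algebra_simps)

lemma quad_mult: "quad a b c * quad a' b' c' =
    quart (a * a') (a * b' + b * a') (a * c' + b * b' + c * a') (b * c' + c * b') (c * c')"
  by (simp add: quad_def quart_def const_add const_mult eval_nat_numeral algebra_simps)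

lemma quart_0: "quart 0 0 0 0 0 = 0"
  by (simp add: quart_def)

lemma const_mult_lin: "const c * lin a b = lin (c * a) (c * b)"
  by (simp add: lin_def const_mult algebra_simps)

lemma x1_eq_lin: "x1 = lin 1 0" and x2_eq_lin: "x2 = lin 0 1"
  by (simp_all add: lin_def)

lemma const_eq_0_iff: "const c = 0 \<longleftrightarrow> c = 0"
  by (metis const_0 const_def lookup_single_eq)

lemma var_neq_0: "var v \<noteq> (0 :: ('v, 'k::comm_ring_1) mpoly)"
  by (metis keys_eq_empty keys_single insert_not_empty var_def zero_neq_one)

text \<open>Setting \<open>x1\<close> to zero leaves only \<open>e\<close> times the fourth power of
  \<open>x2\<close>.\<close>

lemma quart_neq_0: "e \<noteq> 0 \<Longrightarrow> quart a b c d e \<noteq> 0"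
proof
  assume "e \<noteq> 0" and "quart a b c d e = 0"
  define \<phi> :: "S \<Rightarrow> S" where "\<phi> = poly_eval (\<lambda>v. if v = X1 then 0 else var v)"
  have \<phi>: "algebra_hom \<phi>" by (simp add: \<phi>_def poly_eval_hom)
  have "\<phi> x1 = 0" "\<phi> x2 = x2"
    by (simp_all add: \<phi>_def x1_def x2_def)
  then have "const e * x2 ^ 4 = \<phi> (quart a b c d e)"
    by (simp add: quart_def hom_add[OF \<phi>] hom_mult[OF \<phi>] hom_power[OF \<phi>] hom_const[OF \<phi>])
  then show False
    using \<open>e \<noteq> 0\<close> \<open>quart a b c d e = 0\<close>
    by (simp add: hom_0[OF \<phi>] const_eq_0_iff x2_def var_neq_0)
qed

text \<open>The product of \<open>y1\<close> with its translate \<open>y1 + x1\<close> under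
  \<sigma>1; \<open>N2\<close> is the analogue for \<open>y2\<close> and \<sigma>2.\<close>

definition N1 :: S where "N1 = y1 ^ 2 + x1 * y1"
definition N2 :: S where "N2 = y2 ^ 2 + x2 * y2"

text \<open>Writing A and B for the shifts of N1 and N2 under \<sigma>3, and likewise under \<sigma>4,
  the pairs (p1, q1) and (p2, q2) solve A^2 + p1 A + q1 B = 0 and B^2 + p2 A + q2 B = 0 for
  both automorphisms at once.\<close>

definition p1 :: S where "p1 = quad \<alpha> (\<alpha> + \<alpha>^2) (1 + \<alpha> + \<alpha>^2)"
definition q1 :: S where "q1 = quad 0 (\<alpha> + \<alpha>^2) (1 + \<alpha>)"
definition p2 :: S where "p2 = quad (1 + \<alpha>^2) \<alpha> 0"
definition q2 :: S where "q2 = quad (1 + \<alpha>) (1 + \<alpha>) \<alpha>"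

definition h1 :: S where "h1 = N1 ^ 2 + p1 * N1 + q1 * N2"
definition h2 :: S where "h2 = N2 ^ 2 + p2 * N1 + q2 * N2"

lemmas f8_arith = \<alpha>_def one_f8_def zero_f8_def power2_eq_square

lemma fix_x_hom: "algebra_hom (fix_x p q)"
  by (simp add: fix_x_def poly_eval_hom)

lemma fix_x_simps [simp]:
  "fix_x p q x1 = x1" "fix_x p q x2 = x2" "fix_x p q y1 = p" "fix_x p q y2 = q"
  by (simp_all add: fix_x_def x1_def x2_def y1_def y2_def)

lemmas fix_x_add = hom_add[OF fix_x_hom]
  and fix_x_mult = hom_mult[OF fix_x_hom]
  and fix_x_const = hom_const[OF fix_x_hom]
  and fix_x_power = hom_power[OF fix_x_hom]

text \<open>All group elements have this form, and composition adds the vectors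
  \<open>(a, b, c, d)\<close>.\<close>

definition transl :: "f8 \<Rightarrow> f8 \<Rightarrow> f8 \<Rightarrow> f8 \<Rightarrow> S \<Rightarrow> S" where
  "transl a b c d = fix_x (y1 + lin a b) (y2 + lin c d)"

lemma \<sigma>_eq_transl:
  "\<sigma>1 = transl 1 0 0 0" "\<sigma>2 = transl 0 0 0 1"
  "\<sigma>3 = transl (1 + \<alpha>^2) 1 \<alpha> (\<alpha>^2)" "\<sigma>4 = transl (1 + \<alpha>^2) (\<alpha>^2) (1 + \<alpha>^2) (\<alpha>^2)"
  by (simp_all add: \<sigma>1_def \<sigma>2_def \<sigma>3_def \<sigma>4_def transl_def lin_def add.assoc)

lemma transl_hom: "algebra_hom (transl a b c d)"
  by (simp add: transl_def fix_x_hom)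

lemma transl_lin: "transl a b c d (lin e f) = lin e f"
  by (simp add: transl_def lin_def fix_x_add fix_x_mult fix_x_const)

lemma transl_quad: "transl a b c d (quad e f g) = quad e f g"
  by (simp add: transl_def quad_def fix_x_add fix_x_mult fix_x_const fix_x_power)

text \<open>\<open>N1\<close> is additive as a polynomial in \<open>y1\<close>, so a shift of
  \<open>y1\<close> by \<open>u\<close> adds \<open>u * (u + x1)\<close>; the second factor is
  \<open>lin (a + 1) b\<close>.\<close>

lemma transl_N1: "transl a b c d N1 = N1 + lin a b * lin (a + 1) b"
proof -
  have "lin (a + 1) b = lin a b + x1"
    by (simp add: x1_eq_lin lin_add)
  then show ?thesis
    by (simp add: transl_def N1_def fix_x_add fix_x_mult fix_x_power square_add power2_eq_square algebra_simps)
qed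

lemma transl_N2: "transl a b c d N2 = N2 + lin c d * lin c (d + 1)"
proof -
  have "lin c (d + 1) = lin c d + x2"
    by (simp add: x2_eq_lin lin_add)
  then show ?thesis
    by (simp add: transl_def N2_def fix_x_add fix_x_mult fix_x_power square_add power2_eq_square algebra_simps)
qed

text \<open>Squaring is additive in characteristic 2, so \<open>N1\<close> and \<open>N2\<close>
  drop out of the shift. What remains is the expression that \<open>p1\<close> and \<open>q1\<close>
  are chosen to annihilate.\<close>

lemma transl_h1:
  "transl a b c d h1 = h1 + ((lin a b * lin (a + 1) b) ^ 2 + p1 * (lin a b * lin (a + 1) b)
     + q1 * (lin c d * lin c (d + 1)))"
  unfolding h1_def p1_def q1_def
  by (simp add: hom_add[OF transl_hom] hom_mult[OF transl_hom] hom_power[OF transl_hom]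
      transl_quad transl_N1 transl_N2 square_add algebra_simps)

lemma transl_h2:
  "transl a b c d h2 = h2 + ((lin c d * lin c (d + 1)) ^ 2 + p2 * (lin a b * lin (a + 1) b)
     + q2 * (lin c d * lin c (d + 1)))"
  unfolding h2_def p2_def q2_def
  by (simp add: hom_add[OF transl_hom] hom_mult[OF transl_hom] hom_power[OF transl_hom]
      transl_quad transl_N1 transl_N2 square_add algebra_simps)

text \<open>For \<sigma>1 and \<sigma>2 the shifts of \<open>N1\<close> and \<open>N2\<close>
  vanish. For \<sigma>3 and \<sigma>4 the shift of \<open>h1\<close> is a binary quartic whose five
  coefficients evaluate to zero.\<close>

lemma \<sigma>_fixes_h1: "\<sigma>1 h1 = h1" "\<sigma>2 h1 = h1" "\<sigma>3 h1 = h1" "\<sigma>4 h1 = h1"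
  unfolding \<sigma>_eq_transl transl_h1 p1_def q1_def f8_arith
  by (simp_all add: lin_mult quad_mult quad_add quart_add quart_0[unfolded zero_f8_def])

lemma \<sigma>_fixes_h2: "\<sigma>1 h2 = h2" "\<sigma>2 h2 = h2" "\<sigma>3 h2 = h2" "\<sigma>4 h2 = h2"
  unfolding \<sigma>_eq_transl transl_h2 p2_def q2_def f8_arith
  by (simp_all add: lin_mult quad_mult quad_add quart_add quart_0[unfolded zero_f8_def])

lemma lin_0: "lin 0 0 = 0"
  by (simp add: lin_def)

lemma quad_in_subalgebra: "subalgebra A \<Longrightarrow> {x1, x2} \<subseteq> A \<Longrightarrow> quad a b c \<in> A"
  unfolding quad_def by (auto intro!: subalgebraD subalgebra_power)

lemma \<sigma>_hom: "algebra_hom \<sigma>1" "algebra_hom \<sigma>2" "algebra_hom \<sigma>3" "algebra_hom \<sigma>4"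
  by (simp_all add: \<sigma>_eq_transl transl_hom)

lemma \<sigma>_fixes_x: "\<sigma>1 x1 = x1" "\<sigma>2 x1 = x1" "\<sigma>3 x1 = x1" "\<sigma>4 x1 = x1"
  "\<sigma>1 x2 = x2" "\<sigma>2 x2 = x2" "\<sigma>3 x2 = x2" "\<sigma>4 x2 = x2"
  by (simp_all add: \<sigma>_eq_transl transl_def)

lemma \<sigma>_fixes_N: "\<sigma>1 N1 = N1" "\<sigma>2 N1 = N1" "\<sigma>1 N2 = N2" "\<sigma>2 N2 = N2"
  unfolding \<sigma>_eq_transl transl_N1 transl_N2
  by (simp_all add: f8_add_self lin_0)

lemma fixed_on_hull:
  assumes "algebra_hom \<tau>" "\<And>b. b \<in> B \<Longrightarrow> \<tau> b = b" "f \<in> subalgebra hull B"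
  shows "\<tau> f = f"
  using hull_minimal[of B "{f. \<tau> f = f}" subalgebra] subalgebra_fixed[of \<tau>] assms by blast

lemma S_var_cases: "{x1, x2, y1, y2} \<subseteq> A \<Longrightarrow> var v \<in> A"
  by (cases v) (auto simp: x1_def x2_def y1_def y2_def)

lemma \<sigma>_invariant_in_hull:
  assumes "\<sigma>1 f = f" "\<sigma>2 f = f" "\<sigma>3 f = f" "\<sigma>4 f = f"
  shows "f \<in> subalgebra hull {x1, x2, h1, h2}"
proof -
  define A where "A = subalgebra hull {x1, x2, N1, N2}"
  define B where "B = subalgebra hull {x1, x2, h1, h2}"
  have A: "subalgebra A" and B: "subalgebra B"
    by (simp_all add: A_def B_def subalgebra_hull)
  have A_gens: "x1 \<in> A" "x2 \<in> A" "N1 \<in> A" "N2 \<in> A"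
    and B_gens: "x1 \<in> B" "x2 \<in> B" "h1 \<in> B" "h2 \<in> B"
    by (simp_all add: A_def B_def hull_inc)
  have "f \<in> A"
  proof -
    have "subalgebra hull (A \<union> {y1, y2}) = UNIV"
      using in_subalgebra_if_vars[OF subalgebra_hull S_var_cases, of "A \<union> {y1, y2}"] A_gens
      by (auto intro: hull_inc)
    then have "f \<in> subalgebra hull (A \<union> {y1, y2})" by simp
    \<comment> \<open>In characteristic 2 the definitions of \<open>N1\<close> and \<open>N2\<close>
      are already the quadratic relations for \<open>y1\<close> and \<open>y2\<close>.\<close>
    moreover have "y1 * y1 = N1 + x1 * y1 + 0 * y2" "y2 * y2 = N2 + 0 * y1 + x2 * y2"
      by (simp_all add: N1_def N2_def power2_eq_square add.commute add.left_commute)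
    ultimately obtain a b c e where coeffs: "a \<in> A" "b \<in> A" "c \<in> A" "e \<in> A"
      and f: "f = a + b * y1 + c * y2 + e * (y1 * y2)"
      using quadratic_span[OF A, of N1 x1 0 N2 0 x2 y1 y2 f] A_gens subalgebra_0[OF A] by auto
    have "\<sigma>1 y1 = y1 + x1" "\<sigma>1 y2 = y2 + 0" "\<sigma>2 y1 = y1 + 0" "\<sigma>2 y2 = y2 + x2"
      by (simp_all add: \<sigma>1_def \<sigma>2_def)
    moreover have "x1 * x2 - 0 * 0 \<noteq> 0"
      by (simp add: x1_def x2_def var_neq_0)
    moreover have "\<sigma>1 a = a" "\<sigma>2 a = a" if "a \<in> A" for a
      using that unfolding A_def
      by (auto elim!: fixed_on_hull[rotated 2] simp: \<sigma>_hom \<sigma>_fixes_x \<sigma>_fixes_N)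
    ultimately have "f = a"
      using translation_invariant[OF A \<sigma>_hom(1,2), of x1 0 y1 y2 0 x2 a b c e f]
        A_gens subalgebra_0[OF A] coeffs f assms by blast
    with coeffs show "f \<in> A" by simp
  qed
  show ?thesis
  proof -
    have "A \<subseteq> subalgebra hull (B \<union> {N1, N2})"
      unfolding A_def by (intro hull_minimal subalgebra_hull) (auto intro: hull_inc B_gens)
    with \<open>f \<in> A\<close> have "f \<in> subalgebra hull (B \<union> {N1, N2})" by blast
    moreover have "N1 * N1 = h1 + p1 * N1 + q1 * N2" "N2 * N2 = h2 + p2 * N1 + q2 * N2"
      by (simp_all add: h1_def h2_def power2_eq_square add.commute add.left_commute)
    moreover have quad_B: "quad a b c \<in> B" for a b c
      using quad_in_subalgebra[OF B] B_gens by blast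
    ultimately obtain a b c e where coeffs: "a \<in> B" "b \<in> B" "c \<in> B" "e \<in> B"
      and f: "f = a + b * N1 + c * N2 + e * (N1 * N2)"
      using quadratic_span[OF B, of h1 p1 q1 h2 p2 q2 N1 N2 f] B_gens
      unfolding p1_def q1_def p2_def q2_def by auto
    obtain u1 u2 w1 w2 where u: "\<sigma>3 N1 = N1 + u1" "\<sigma>3 N2 = N2 + u2" "\<sigma>4 N1 = N1 + w1" "\<sigma>4 N2 = N2 + w2"
      and uB: "u1 \<in> B" "u2 \<in> B" "w1 \<in> B" "w2 \<in> B" and det: "u1 * w2 - u2 * w1 \<noteq> 0"
    proof
      \<comment> \<open>The witnesses are the products \<open>u * (u + x1)\<close> and
        \<open>v * (v + x2)\<close>, expanded for the shifts \<open>u\<close>, \<open>v\<close> of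
        \<open>y1\<close>, \<open>y2\<close>.\<close>
      show "\<sigma>3 N1 = N1 + quad (F8 0 1 0) 1 1" "\<sigma>3 N2 = N2 + quad (F8 0 0 1) (F8 0 1 0) (F8 0 1 0)"
        "\<sigma>4 N1 = N1 + quad (F8 0 1 0) (F8 0 0 1) (F8 0 1 1)"
        "\<sigma>4 N2 = N2 + quad (F8 1 1 1) (F8 1 0 1) (F8 0 1 0)"
        unfolding \<sigma>_eq_transl transl_N1 transl_N2 lin_mult f8_arith by simp_all
      \<comment> \<open>The coefficient of \<open>x2 ^ 4\<close> in this determinant is 1 +
        \<alpha>^2, which is not zero.\<close>
      show "quad (F8 0 1 0) 1 1 * quad (F8 1 1 1) (F8 1 0 1) (F8 0 1 0) -
          quad (F8 0 0 1) (F8 0 1 0) (F8 0 1 0) * quad (F8 0 1 0) (F8 0 0 1) (F8 0 1 1) \<noteq> 0"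
        unfolding diff_eq_add quad_mult quart_add
        by (rule quart_neq_0) (simp add: f8_arith)
    qed (rule quad_B)+
    have "\<sigma>3 a = a" "\<sigma>4 a = a" if "a \<in> B" for a
      using that unfolding B_def
      by (auto elim!: fixed_on_hull[rotated 2] simp: \<sigma>_hom \<sigma>_fixes_x \<sigma>_fixes_h1 \<sigma>_fixes_h2)
    then have "f = a"
      using translation_invariant[OF B \<sigma>_hom(3,4), of u1 u2 N1 N2 w1 w2 a b c e f]
        u uB det coeffs f assms by blast
    with coeffs show "f \<in> subalgebra hull {x1, x2, h1, h2}" by (simp add: B_def)
  qed
qed

section \<open>Algebraic independence of the generators\<close>

text \<open>The type \<open>xy_var\<close> also indexes the variables of the presenting ring, where
  \<open>Y1\<close> and \<open>Y2\<close> stand for \<open>h1\<close> and \<open>h2\<close>. So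
  \<open>poly_eval gen\<close> maps \<open>S\<close> to itself.\<close>

primrec gen :: "xy_var \<Rightarrow> S" where
  "gen X1 = x1" | "gen X2 = x2" | "gen Y1 = h1" | "gen Y2 = h2"

lemma UNIV_xy_var: "UNIV = {X1, X2, Y1, Y2}"
  using xy_var.exhaust by auto

lemma range_gen: "range gen = {x1, x2, h1, h2}"
  by (simp add: UNIV_xy_var)

lemma \<sigma>_fixes_gen: "\<sigma>1 (gen v) = gen v" "\<sigma>2 (gen v) = gen v" "\<sigma>3 (gen v) = gen v" "\<sigma>4 (gen v) = gen v"
  by (cases v; simp add: \<sigma>_fixes_x \<sigma>_fixes_h1 \<sigma>_fixes_h2)+

text \<open>The order of vanishing along \<open>x1 = x2 = 0\<close>, where \<open>h1\<close> and
  \<open>h2\<close> reduce to fourth powers.\<close>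

primrec xdeg :: "xy_var \<Rightarrow> nat" where
  "xdeg X1 = 1" | "xdeg X2 = 1" | "xdeg Y1 = 0" | "xdeg Y2 = 0"

text \<open>The grading of the presenting ring that makes \<open>poly_eval gen\<close> preserve
  degrees.\<close>

primrec degs :: "xy_var \<Rightarrow> nat" where
  "degs X1 = 1" | "degs X2 = 1" | "degs Y1 = 4" | "degs Y2 = 4"

lemma homogeneous_gen: "whomogeneous (\<lambda>_. 1) (degs v) (gen v)"
proof -
  have x: "whomogeneous (\<lambda>_. 1) 1 x1" "whomogeneous (\<lambda>_. 1) 1 x2"
    and y: "whomogeneous (\<lambda>_. 1) 1 y1" "whomogeneous (\<lambda>_. 1) 1 y2"
    unfolding x1_def x2_def y1_def y2_def by (rule whomogeneous_var)+
  have mult: "whomogeneous (\<lambda>_. 1) 2 (f * g)" if "whomogeneous (\<lambda>_. 1) 1 f" "whomogeneous (\<lambda>_. 1) 1 g"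
    for f g :: S
    using whomogeneous_mult[OF that] by (simp add: numeral_2_eq_2)
  have mult4: "whomogeneous (\<lambda>_. 1) 4 (f * g)" if "whomogeneous (\<lambda>_. 1) 2 f" "whomogeneous (\<lambda>_. 1) 2 g"
    for f g :: S
    using whomogeneous_mult[OF that] by simp
  have N: "whomogeneous (\<lambda>_. 1) 2 N1" "whomogeneous (\<lambda>_. 1) 2 N2"
    unfolding N1_def N2_def power2_eq_square by (intro whomogeneous_add mult x y)+
  have "whomogeneous (\<lambda>_. 1) 2 (quad a b c)" for a b c
    unfolding quad_def power2_eq_square
    by (intro whomogeneous_add whomogeneous_const_mult mult x)
  then have "whomogeneous (\<lambda>_. 1) 4 h1" "whomogeneous (\<lambda>_. 1) 4 h2"
    unfolding h1_def h2_def p1_def q1_def p2_def q2_def power2_eq_square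
    by (intro whomogeneous_add mult4 N; assumption)+
  with x show ?thesis by (cases v) simp_all
qed

lemma monom_eval_xy:
  "monom_eval s m = s X1 ^ lookup m X1 * s X2 ^ lookup m X2 * s Y1 ^ lookup m Y1 * s Y2 ^ lookup m Y2"
  by (subst monom_eval_superset[of UNIV], simp, simp) (simp add: UNIV_xy_var mult.assoc)

lemma weight_xy:
  "weight w m = w X1 * lookup m X1 + w X2 * lookup m X2 + w Y1 * lookup m Y1 + w Y2 * lookup m Y2"
  by (subst weight_superset[of UNIV], simp, simp) (simp add: UNIV_xy_var add.assoc)

lemma xy_poly_mapping_eqI:
  fixes m n :: "xy_var \<Rightarrow>\<^sub>0 nat"
  assumes "lookup m X1 = lookup n X1" "lookup m X2 = lookup n X2"
    "lookup m Y1 = lookup n Y1" "lookup m Y2 = lookup n Y2"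
  shows "m = n"
proof (rule poly_mapping_eqI)
  fix v show "lookup m v = lookup n v"
    by (cases v) (simp_all add: assms)
qed

text \<open>Congruence modulo the ideal \<open>weight_ge w d\<close> passes to powers.\<close>

lemma power_eq_mod:
  assumes "f = g + r" "r \<in> weight_ge w d"
  shows "\<exists>r\<in>weight_ge w d. f ^ n = g ^ n + r"
proof (induction n)
  case 0
  show ?case by (rule bexI[of _ 0]) (simp_all add: weight_ge_def)
next
  case (Suc n)
  then obtain r' where r': "r' \<in> weight_ge w d" "f ^ n = g ^ n + r'" by blast
  have "f ^ Suc n = g * f ^ n + f ^ n * r"
    by (simp add: assms(1) distrib_left distrib_right mult.commute)
  also have "g * f ^ n = g ^ Suc n + g * r'"
    unfolding r'(2) by (simp add: distrib_left)
  finally have "f ^ Suc n = g ^ Suc n + (g * r' + f ^ n * r)"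
    by (simp add: add.assoc)
  moreover have "g * r' + f ^ n * r \<in> weight_ge w d"
    by (intro weight_ge_add weight_ge_mult_left r' assms)
  ultimately show ?case by blast
qed

lemma h_eq_mod:
  "\<exists>r\<in>weight_ge xdeg 1. h1 = y1 ^ 4 + r" "\<exists>r\<in>weight_ge xdeg 1. h2 = y2 ^ 4 + r"
proof -
  have N1_square: "N1 ^ 2 = y1 ^ 4 + x1 * (x1 * y1 ^ 2)"
    and N2_square: "N2 ^ 2 = y2 ^ 4 + x2 * (x2 * y2 ^ 2)"
    unfolding N1_def N2_def square_add by (simp_all add: eval_nat_numeral algebra_simps)
  have x: "x1 \<in> weight_ge xdeg 1" "x2 \<in> weight_ge xdeg 1"
    by (simp_all add: x1_def x2_def var_def weight_ge_def weight_single)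
  have x_mult: "x1 * f \<in> weight_ge xdeg 1" "x2 * f \<in> weight_ge xdeg 1" for f
    using weight_ge_mult_left[OF x(1), of f] weight_ge_mult_left[OF x(2), of f] by (simp_all add: mult.commute)
  have quad: "quad a b c * f \<in> weight_ge xdeg 1" for a b c f
  proof -
    have "quad a b c * f = x1 * (const a * x1 * f) + (x1 * (const b * x2 * f) + x2 * (const c * x2 * f))"
      by (simp add: quad_def power2_eq_square algebra_simps)
    then show ?thesis
      by (simp only:) (intro weight_ge_add x_mult)
  qed
  have "h1 = y1 ^ 4 + (x1 * (x1 * y1 ^ 2) + (p1 * N1 + q1 * N2))"
    by (simp add: h1_def N1_square add.assoc)
  moreover have "x1 * (x1 * y1 ^ 2) + (p1 * N1 + q1 * N2) \<in> weight_ge xdeg 1"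
    unfolding p1_def q1_def by (intro weight_ge_add x_mult quad)
  ultimately show "\<exists>r\<in>weight_ge xdeg 1. h1 = y1 ^ 4 + r" by blast
  have "h2 = y2 ^ 4 + (x2 * (x2 * y2 ^ 2) + (p2 * N1 + q2 * N2))"
    by (simp add: h2_def N2_square add.assoc)
  moreover have "x2 * (x2 * y2 ^ 2) + (p2 * N1 + q2 * N2) \<in> weight_ge xdeg 1"
    unfolding p2_def q2_def by (intro weight_ge_add x_mult quad)
  ultimately show "\<exists>r\<in>weight_ge xdeg 1. h2 = y2 ^ 4 + r" by blast
qed

text \<open>The exponent vector of the term of lowest x-degree in the image of a monomial. Being
  injective, it keeps the images of different monomials apart.\<close>

definition stretch :: "(xy_var \<Rightarrow>\<^sub>0 nat) \<Rightarrow> (xy_var \<Rightarrow>\<^sub>0 nat)" where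
  "stretch m = single X1 (lookup m X1) + single X2 (lookup m X2) +
     single Y1 (4 * lookup m Y1) + single Y2 (4 * lookup m Y2)"

lemma lookup_stretch:
  "lookup (stretch m) X1 = lookup m X1" "lookup (stretch m) X2 = lookup m X2"
  "lookup (stretch m) Y1 = 4 * lookup m Y1" "lookup (stretch m) Y2 = 4 * lookup m Y2"
  by (simp_all add: stretch_def lookup_add lookup_single)

lemma stretch_inject: "stretch m = stretch n \<longleftrightarrow> m = n"
proof
  assume "stretch m = stretch n"
  then have "lookup (stretch m) v = lookup (stretch n) v" for v by simp
  from this[of X1] this[of X2] this[of Y1] this[of Y2]
  show "m = n" by (intro xy_poly_mapping_eqI) (simp_all add: lookup_stretch)
qed simp

lemma monom_eval_gen_mod:
  "\<exists>r\<in>weight_ge xdeg (weight xdeg m + 1). monom_eval gen m = single (stretch m) 1 + r"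
proof -
  obtain r s where r: "r \<in> weight_ge xdeg 1" "h1 ^ lookup m Y1 = (y1 ^ 4) ^ lookup m Y1 + r"
    and s: "s \<in> weight_ge xdeg 1" "h2 ^ lookup m Y2 = (y2 ^ 4) ^ lookup m Y2 + s"
    using power_eq_mod[of h1 "y1 ^ 4" _ xdeg 1 "lookup m Y1"]
      power_eq_mod[of h2 "y2 ^ 4" _ xdeg 1 "lookup m Y2"] h_eq_mod by blast
  define x where "x = x1 ^ lookup m X1 * x2 ^ lookup m X2"
  have x: "x = single (single X1 (lookup m X1) + single X2 (lookup m X2)) 1"
    unfolding x_def x1_def x2_def var_power mult_single by simp
  have y: "(y1 ^ 4) ^ k = single (single Y1 (4 * k)) 1" "(y2 ^ 4) ^ k = single (single Y2 (4 * k)) 1" for k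
    unfolding y1_def y2_def power_mult [symmetric] by (rule var_power)+
  have "monom_eval gen m = x * ((y1 ^ 4) ^ lookup m Y1 + r) * ((y2 ^ 4) ^ lookup m Y2 + s)"
    by (simp add: monom_eval_xy x_def flip: r(2) s(2))
  also have "\<dots> = x * ((y1 ^ 4) ^ lookup m Y1 * (y2 ^ 4) ^ lookup m Y2) +
      x * ((y1 ^ 4) ^ lookup m Y1 * s + h2 ^ lookup m Y2 * r)"
    by (simp add: s(2) algebra_simps)
  also have "x * ((y1 ^ 4) ^ lookup m Y1 * (y2 ^ 4) ^ lookup m Y2) = single (stretch m) 1"
    unfolding x y mult_single by (simp add: stretch_def add.assoc)
  finally have "monom_eval gen m = single (stretch m) 1 +
      x * ((y1 ^ 4) ^ lookup m Y1 * s + h2 ^ lookup m Y2 * r)" .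
  moreover have "x \<in> weight_ge xdeg (weight xdeg m)"
    by (simp add: x weight_ge_def weight_xy lookup_add lookup_single)
  then have "x * ((y1 ^ 4) ^ lookup m Y1 * s + h2 ^ lookup m Y2 * r) \<in> weight_ge xdeg (weight xdeg m + 1)"
    by (intro weight_ge_mult weight_ge_add weight_ge_mult_left r s)
  ultimately show ?thesis by blast
qed

text \<open>The image of a monomial of least x-degree survives modulo higher x-degree, where
  h1 and h2 become fourth powers of y1 and y2.\<close>

lemma inj_gen: "inj (poly_eval gen)"
proof (rule injI)
  fix f g :: S
  assume eq: "poly_eval gen f = poly_eval gen g"
  show "f = g"
  proof (rule ccontr)
    define p where "p = f - g"
    assume "f \<noteq> g"
    then have "keys p \<noteq> {}" by (simp add: p_def)
    then obtain m where m: "m \<in> keys p" "\<And>n. n \<in> keys p \<Longrightarrow> weight xdeg m \<le> weight xdeg n"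
      using arg_min_least[of "keys p" _ "weight xdeg"] arg_min_if_finite(1)[of "keys p" "weight xdeg"]
      by (metis finite_keys)
    \<comment> \<open>The remainder in the image of \<open>n\<close> has x-degree above that of
      \<open>n\<close>, hence above the minimum attained at \<open>m\<close>. It cannot contain
      \<open>stretch m\<close>.\<close>
    have "lookup (monom_eval gen n) (stretch m) = (1 when n = m)" if "n \<in> keys p" for n
    proof -
      obtain r where r: "r \<in> weight_ge xdeg (weight xdeg n + 1)" "monom_eval gen n = single (stretch n) 1 + r"
        using monom_eval_gen_mod by blast
      have "weight xdeg (stretch m) = weight xdeg m"
        by (simp add: weight_xy lookup_stretch)
      with m(2)[OF that] r(1) have "stretch m \<notin> keys r"
        by (auto simp: weight_ge_def)
      then show ?thesis
        by (simp add: r(2) lookup_add lookup_single stretch_inject in_keys_iff)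
    qed
    then have "lookup (poly_eval gen p) (stretch m) = (\<Sum>n\<in>keys p. if n = m then lookup p m else 0)"
      unfolding poly_eval_superset[OF finite_keys order_refl] lookup_sum lookup_const_mult
      by (intro sum.cong refl) (simp add: when_def)
    with m(1) have "lookup (poly_eval gen p) (stretch m) \<noteq> 0"
      by (simp add: in_keys_iff)
    moreover have "poly_eval gen p = 0"
      by (simp add: p_def poly_eval_diff eq)
    ultimately show False by simp
  qed
qed

section \<open>Minimal generating sets\<close>

lemma poly_eval_gen_homogeneous: "whomogeneous degs d f \<Longrightarrow> homogeneous d (poly_eval gen f)"
  unfolding homogeneous_eq_whomogeneous by (rule whomogeneous_poly_eval[OF homogeneous_gen])

lemma whomogeneous_if_homogeneous: "homogeneous d (poly_eval gen f) \<Longrightarrow> whomogeneous degs d f"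
  unfolding homogeneous_eq_whomogeneous by (rule whomogeneous_if_poly_eval[OF inj_gen homogeneous_gen])

lemma single_eq_const_mult_var: "single (single v 1) c = const c * var v"
  by (simp add: var_def const_mult_single)

lemma weight_degs_1:
  assumes "weight degs m = 1"
  shows "m = single X1 1 \<or> m = single X2 1"
proof -
  have "lookup m X1 + lookup m X2 + 4 * lookup m Y1 + 4 * lookup m Y2 = 1"
    using assms by (simp add: weight_xy)
  then have "lookup m X1 + lookup m X2 = 1" "lookup m Y1 = 0" "lookup m Y2 = 0"
    by arith+
  then consider "lookup m X1 = 1" "lookup m X2 = 0" | "lookup m X1 = 0" "lookup m X2 = 1"
    by linarith
  then show ?thesis
  proof cases
    case 1
    then have "m = single X1 1"
      by (intro xy_poly_mapping_eqI) (simp_all add: lookup_single \<open>lookup m Y1 = 0\<close> \<open>lookup m Y2 = 0\<close>)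
    then show ?thesis ..
  next
    case 2
    then have "m = single X2 1"
      by (intro xy_poly_mapping_eqI) (simp_all add: lookup_single \<open>lookup m Y1 = 0\<close> \<open>lookup m Y2 = 0\<close>)
    then show ?thesis ..
  qed
qed

lemma weight_degs_4:
  assumes "weight degs m = 4"
  shows "m = single Y1 1 \<or> m = single Y2 1 \<or> keys m \<subseteq> {X1, X2}"
proof -
  have eq: "lookup m X1 + lookup m X2 + 4 * lookup m Y1 + 4 * lookup m Y2 = 4"
    using assms by (simp add: weight_xy)
  then consider "lookup m X1 = 0" "lookup m X2 = 0" "lookup m Y1 = 1" "lookup m Y2 = 0"
    | "lookup m X1 = 0" "lookup m X2 = 0" "lookup m Y1 = 0" "lookup m Y2 = 1"
    | "lookup m Y1 = 0" "lookup m Y2 = 0" by linarith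
  then show ?thesis
  proof cases
    case 1
    then have "m = single Y1 1"
      by (intro xy_poly_mapping_eqI) (simp_all add: lookup_single)
    then show ?thesis ..
  next
    case 2
    then have "m = single Y2 1"
      by (intro xy_poly_mapping_eqI) (simp_all add: lookup_single)
    then show ?thesis by blast
  next
    case 3
    have "v \<in> {X1, X2}" if "v \<in> keys m" for v
      using that 3 by (cases v) (simp_all add: in_keys_iff)
    then show ?thesis by blast
  qed
qed

lemma single_neq: "v \<noteq> w \<Longrightarrow> single v (1::nat) \<noteq> single w 1"
  by (metis lookup_single_eq lookup_single_not_eq zero_neq_one)

lemma eq_sum_if_keys_subset:
  assumes "keys f \<subseteq> {single v 1, single w 1}" "v \<noteq> w"
  shows "f = const (lookup f (single v 1)) * var v + const (lookup f (single w 1)) * var w"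
  using poly_mapping_sum_superset[of "{single v 1, single w 1}" f] assms single_neq[of v w]
  by (simp add: single_eq_const_mult_var del: One_nat_def)

lemma whomogeneous_degs_1:
  assumes "whomogeneous degs 1 f"
  shows "f = const (lookup f (single X1 1)) * x1 + const (lookup f (single X2 1)) * x2"
  unfolding x1_def x2_def
  by (rule eq_sum_if_keys_subset) (use assms weight_degs_1 in \<open>auto simp: whomogeneous_def\<close>)

text \<open>The part \<open>r\<close> involves only \<open>x1\<close> and \<open>x2\<close>, so it
  can be subtracted once these two are available in the subalgebra.\<close>

lemma whomogeneous_degs_4:
  assumes f: "whomogeneous degs 4 f"
  shows "\<exists>r. f = const (lookup f (single Y1 1)) * y1 + const (lookup f (single Y2 1)) * y2 + r
    \<and> indets r \<subseteq> {X1, X2}"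
proof -
  define M where "M = keys f - {single Y1 1, single Y2 1}"
  define r where "r = (\<Sum>m\<in>M. single m (lookup f m))"
  have M: "finite M" "single Y1 1 \<notin> M" "single Y2 1 \<notin> M"
    and keys: "keys f \<subseteq> insert (single Y1 1) (insert (single Y2 1) M)"
    by (auto simp: M_def)
  have "f = (\<Sum>m\<in>insert (single Y1 1) (insert (single Y2 1) M). single m (lookup f m))"
    using poly_mapping_sum_superset[OF _ keys] M by simp
  also have "\<dots> = const (lookup f (single Y1 1)) * y1 + const (lookup f (single Y2 1)) * y2 + r"
    using M single_neq[of Y1 Y2]
    by (simp add: r_def single_eq_const_mult_var y1_def y2_def add.assoc del: One_nat_def)
  finally have "f = const (lookup f (single Y1 1)) * y1 + const (lookup f (single Y2 1)) * y2 + r" .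
  moreover have "r \<in> {r. indets r \<subseteq> {X1, X2}}"
    unfolding r_def
  proof (rule subalgebra_sum[OF subalgebra_indets])
    fix m assume "m \<in> M"
    then have "keys m \<subseteq> {X1, X2}"
      using f weight_degs_4[of m] by (auto simp: M_def whomogeneous_def)
    then show "single m (lookup f m) \<in> {r. indets r \<subseteq> {X1, X2}}"
      by (simp add: indets_def)
  qed
  ultimately show ?thesis by blast
qed

text \<open>Cramer's rule over the constants; minus signs become plus signs in characteristic
  2.\<close>

lemma cramer_in_subalgebra:
  fixes y z :: "('v, f8) mpoly"
  assumes A: "subalgebra A"
    and "const a * y + const b * z \<in> A" "const a' * y + const b' * z \<in> A"
    and det: "a * b' + b * a' \<noteq> 0"
  shows "y \<in> A" "z \<in> A"
proof -
  define D where "D = inverse (a * b' + b * a')"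
  have D: "const D * const (a * b' + b * a') = (1 :: ('v, f8) mpoly)"
    using det by (simp add: D_def flip: const_mult)
  have "const D * (const b' * (const a * y + const b * z) + const b * (const a' * y + const b' * z)) \<in> A"
    by (intro subalgebraD[OF A] assms(2,3))
  also have "const D * (const b' * (const a * y + const b * z) + const b * (const a' * y + const b' * z)) =
      (const D * const (a * b' + b * a')) * y"
    by (simp add: const_add const_mult algebra_simps)
  finally show "y \<in> A" by (simp add: D)
  have "const D * (const a' * (const a * y + const b * z) + const a * (const a' * y + const b' * z)) \<in> A"
    by (intro subalgebraD[OF A] assms(2,3))
  also have "const D * (const a' * (const a * y + const b * z) + const a * (const a' * y + const b' * z)) =
      (const D * const (a * b' + b * a')) * z"
    by (simp add: const_add const_mult algebra_simps)
  finally show "z \<in> A" by (simp add: D)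
qed

text \<open>Otherwise one nonzero tangent vector at the origin would kill all of \<open>C\<close>,
  hence the whole ring, including \<open>var v\<close> and \<open>var w\<close>.\<close>

lemma generators_linear_coeffs:
  fixes C :: "('v, 'k::comm_ring_1) mpoly set"
  assumes "subalgebra hull C = UNIV" "v \<noteq> w" "a \<noteq> 0 \<or> b \<noteq> 0"
  shows "\<exists>c\<in>C. a * lookup c (single v 1) + b * lookup c (single w 1) \<noteq> 0"
proof (rule ccontr)
  define t where "t u = (if u = v then a else b)" for u
  assume none: "\<not> ?thesis"
  have "C \<subseteq> {f. (\<Sum>u\<in>{v, w}. t u * lookup f (single u 1)) = 0}"
  proof
    fix c assume "c \<in> C"
    with none have "a * lookup c (single v 1) + b * lookup c (single w 1) = 0" by blast
    with assms(2) show "c \<in> {f. (\<Sum>u\<in>{v, w}. t u * lookup f (single u 1)) = 0}"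
      by (simp add: t_def)
  qed
  then have "subalgebra hull C \<subseteq> {f. (\<Sum>u\<in>{v, w}. t u * lookup f (single u 1)) = 0}"
    by (rule hull_minimal) (rule subalgebra_linear_coeffs)
  then have "f \<in> {f. (\<Sum>u\<in>{v, w}. t u * lookup f (single u 1)) = 0}" for f :: "('v, 'k) mpoly"
    unfolding assms(1) by (rule subsetD[OF _ UNIV_I])
  then have "(\<Sum>u\<in>{v, w}. t u * lookup f (single u 1)) = 0" for f :: "('v, 'k) mpoly"
    by (rule CollectD)
  moreover have "(\<Sum>u\<in>{v, w}. t u * lookup f (single u 1)) = a * lookup f (single v 1) + b * lookup f (single w 1)"
    for f :: "('v, 'k) mpoly"
    using assms(2) by (simp add: t_def)
  ultimately have zero: "a * lookup f (single v 1) + b * lookup f (single w 1) = 0" for f :: "('v, 'k) mpoly"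
    by metis
  have "a = 0" "b = 0"
    using zero[of "var v"] zero[of "var w"] single_neq[OF assms(2)] single_neq[OF assms(2)[symmetric]]
    by (simp_all add: var_def lookup_single del: One_nat_def)
  with assms(3) show False by simp
qed

lemma whomogeneous_degree_eq:
  "whomogeneous w d f \<Longrightarrow> lookup f (single v 1) \<noteq> 0 \<Longrightarrow> d = w v"
  using weight_single[of w v 1] by (auto simp: whomogeneous_def in_keys_iff simp del: One_nat_def)

text \<open>A homogeneous polynomial with a nonzero coefficient at \<open>var v\<close> or
  \<open>var w\<close> must have the common weight of these variables, which fixes the weight of
  both chosen generators.\<close>

lemma generators_pair:
  fixes C :: "S set"
  assumes C: "subalgebra hull C = UNIV" and hom: "\<And>c. c \<in> C \<Longrightarrow> \<exists>d. whomogeneous degs d c"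
    and "v \<noteq> w" "degs v = degs w"
  obtains c c' where "c \<in> C" "c' \<in> C" "whomogeneous degs (degs v) c" "whomogeneous degs (degs v) c'"
    "lookup c (single v 1) * lookup c' (single w 1) + lookup c (single w 1) * lookup c' (single v 1) \<noteq> 0"
    "c \<noteq> c'" "c \<noteq> 0" "c' \<noteq> 0"
proof -
  obtain c where c: "c \<in> C" "1 * lookup c (single v 1) + 0 * lookup c (single w 1) \<noteq> 0"
    using generators_linear_coeffs[OF C \<open>v \<noteq> w\<close>, of 1 0] by auto
  then have cv: "lookup c (single v 1) \<noteq> 0" by simp
  \<comment> \<open>The functional has the two linear coefficients of \<open>c\<close> in exchanged
    order, so its value at a generator is the determinant with \<open>c\<close> in characteristic
    2.\<close>
  obtain c' where c': "c' \<in> C"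
    "lookup c (single w 1) * lookup c' (single v 1) + lookup c (single v 1) * lookup c' (single w 1) \<noteq> 0"
    using generators_linear_coeffs[OF C \<open>v \<noteq> w\<close>, of "lookup c (single w 1)" "lookup c (single v 1)"] cv
    by blast
  then have "lookup c' (single v 1) \<noteq> 0 \<or> lookup c' (single w 1) \<noteq> 0" by auto
  with hom[OF c(1)] hom[OF c'(1)] cv have "whomogeneous degs (degs v) c" "whomogeneous degs (degs v) c'"
    using whomogeneous_degree_eq \<open>degs v = degs w\<close> by metis+
  moreover have "c \<noteq> c'"
    using c'(2) by (auto simp: mult.commute f8_add_self)
  moreover have "c \<noteq> 0" "c' \<noteq> 0"
    using c'(2) by auto
  ultimately show ?thesis
    using that[OF c(1) c'(1)] c'(2) by (simp add: add.commute)
qed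

text \<open>The linear coefficients of a product of polynomials involve only linear and constant
  coefficients, so a generating set must span them; generators of weight 1 and 4 with
  independent linear coefficients already generate.\<close>

lemma weighted_generators:
  fixes C :: "S set"
  assumes C: "subalgebra hull C = UNIV" and hom: "\<And>c. c \<in> C \<Longrightarrow> \<exists>d. whomogeneous degs d c"
  obtains c1 c2 c3 c4 where "{c1, c2, c3, c4} \<subseteq> C" "distinct [c1, c2, c3, c4]" "0 \<notin> {c1, c2, c3, c4}"
    "whomogeneous degs 1 c1" "whomogeneous degs 1 c2" "whomogeneous degs 4 c3" "whomogeneous degs 4 c4"
    "subalgebra hull {c1, c2, c3, c4} = UNIV"
proof -
  obtain c1 c2 where c12: "c1 \<in> C" "c2 \<in> C" "whomogeneous degs (degs X1) c1" "whomogeneous degs (degs X1) c2"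
    "lookup c1 (single X1 1) * lookup c2 (single X2 1) + lookup c1 (single X2 1) * lookup c2 (single X1 1) \<noteq> 0"
    "c1 \<noteq> c2" "c1 \<noteq> 0" "c2 \<noteq> 0"
    by (rule generators_pair[OF C hom, of X1 X2]) simp_all
  obtain c3 c4 where c34: "c3 \<in> C" "c4 \<in> C" "whomogeneous degs (degs Y1) c3" "whomogeneous degs (degs Y1) c4"
    "lookup c3 (single Y1 1) * lookup c4 (single Y2 1) + lookup c3 (single Y2 1) * lookup c4 (single Y1 1) \<noteq> 0"
    "c3 \<noteq> c4" "c3 \<noteq> 0" "c4 \<noteq> 0"
    by (rule generators_pair[OF C hom, of Y1 Y2]) simp_all
  have w: "whomogeneous degs 1 c1" "whomogeneous degs 1 c2" "whomogeneous degs 4 c3" "whomogeneous degs 4 c4"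
    using c12(3,4) c34(3,4) by simp_all
  have neq: "f \<noteq> g" if "whomogeneous degs 1 f" "whomogeneous degs 4 g" "f \<noteq> 0" for f g :: S
    using whomogeneous_unique[of degs 1 f 4] that by auto
  have dist: "distinct [c1, c2, c3, c4]"
    using c12(6) c34(6) neq[OF w(1) w(3)] neq[OF w(1) w(4)] neq[OF w(2) w(3)] neq[OF w(2) w(4)]
      c12(7,8) by simp
  define A where "A = subalgebra hull {c1, c2, c3, c4}"
  have A: "subalgebra A" and cA: "c1 \<in> A" "c2 \<in> A" "c3 \<in> A" "c4 \<in> A"
    by (simp_all add: A_def subalgebra_hull hull_inc)
  have x: "x1 \<in> A" "x2 \<in> A"
    using cramer_in_subalgebra[OF A _ _ c12(5), of x1 x2] cA(1,2)
      whomogeneous_degs_1[OF w(1)] whomogeneous_degs_1[OF w(2)] by simp_all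
  have "const (lookup c (single Y1 1)) * y1 + const (lookup c (single Y2 1)) * y2 \<in> A"
    if c: "whomogeneous degs 4 c" "c \<in> A" for c
  proof -
    obtain r where r: "c = const (lookup c (single Y1 1)) * y1 + const (lookup c (single Y2 1)) * y2 + r"
      "indets r \<subseteq> {X1, X2}"
      using whomogeneous_degs_4[OF c(1)] by blast
    have "var v \<in> A" if "v \<in> indets r" for v
      using that r(2) x by (auto simp: x1_def x2_def)
    then have "r \<in> A"
      by (rule in_subalgebra_if_indets[OF A])
    with subalgebra_diff[OF A c(2)] have "c - r \<in> A" by blast
    also have "c - r = const (lookup c (single Y1 1)) * y1 + const (lookup c (single Y2 1)) * y2"
      using r(1) by (metis add_diff_cancel_right')
    finally show ?thesis .
  qed
  from cramer_in_subalgebra[OF A this[OF w(3) cA(3)] this[OF w(4) cA(4)] c34(5)]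
  have y: "y1 \<in> A" "y2 \<in> A" .
  have "f \<in> A" for f
    by (rule in_subalgebra_if_vars[OF A S_var_cases]) (use x y in auto)
  then have "subalgebra hull {c1, c2, c3, c4} = UNIV" by (auto simp: A_def)
  then show ?thesis
    using that[of c1 c2 c3 c4] c12 c34 dist w by auto
qed

text \<open>Since \<open>poly_eval gen\<close> is injective and reflects homogeneity,
  \<open>B\<close> can be pulled back to the weighted polynomial ring and the four generators pushed
  forward again.\<close>

lemma homogeneous_generators:
  assumes B: "subalgebra hull B = range (poly_eval gen)" and hom: "\<And>b. b \<in> B \<Longrightarrow> \<exists>d. homogeneous d b"
  obtains b1 b2 b3 b4 where "{b1, b2, b3, b4} \<subseteq> B" "distinct [b1, b2, b3, b4]" "0 \<notin> {b1, b2, b3, b4}"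
    "homogeneous 1 b1" "homogeneous 1 b2" "homogeneous 4 b3" "homogeneous 4 b4"
    "subalgebra hull {b1, b2, b3, b4} = range (poly_eval gen)"
proof -
  let ?\<Phi> = "poly_eval gen"
  define C where "C = ?\<Phi> -` B"
  have "B \<subseteq> range ?\<Phi>"
    using hull_subset[of B subalgebra] B by simp
  then have B_eq: "?\<Phi> ` C = B" by (auto simp: C_def)
  then have "?\<Phi> ` (subalgebra hull C) = ?\<Phi> ` UNIV"
    using B by (simp add: hull_image[OF poly_eval_hom, symmetric])
  then have "subalgebra hull C = UNIV"
    using inj_gen by (simp add: inj_image_eq_iff)
  moreover have "\<exists>d. whomogeneous degs d c" if "c \<in> C" for c
    using hom[of "?\<Phi> c"] that whomogeneous_if_homogeneous unfolding C_def by blast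
  ultimately obtain c1 c2 c3 c4 where c: "{c1, c2, c3, c4} \<subseteq> C" "distinct [c1, c2, c3, c4]" "0 \<notin> {c1, c2, c3, c4}"
    "whomogeneous degs 1 c1" "whomogeneous degs 1 c2" "whomogeneous degs 4 c3" "whomogeneous degs 4 c4"
    "subalgebra hull {c1, c2, c3, c4} = UNIV"
    by (rule weighted_generators)
  have inj: "?\<Phi> f = ?\<Phi> g \<longleftrightarrow> f = g" for f g
    using inj_gen by (auto dest: injD)
  show ?thesis
  proof (rule that[of "?\<Phi> c1" "?\<Phi> c2" "?\<Phi> c3" "?\<Phi> c4"])
    show "{?\<Phi> c1, ?\<Phi> c2, ?\<Phi> c3, ?\<Phi> c4} \<subseteq> B"
      using c(1) by (auto simp: C_def)
    show "distinct [?\<Phi> c1, ?\<Phi> c2, ?\<Phi> c3, ?\<Phi> c4]"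
      using c(2) by (simp add: inj)
    show "0 \<notin> {?\<Phi> c1, ?\<Phi> c2, ?\<Phi> c3, ?\<Phi> c4}"
      using c(3) inj[of 0] by (auto simp: hom_0[OF poly_eval_hom])
    show "subalgebra hull {?\<Phi> c1, ?\<Phi> c2, ?\<Phi> c3, ?\<Phi> c4} = range ?\<Phi>"
      using hull_image[OF poly_eval_hom, of gen "{c1, c2, c3, c4}"] c(8) by simp
  qed (use c in \<open>auto intro: poly_eval_gen_homogeneous\<close>)
qed

text \<open>Every homogeneous generating set contains four generators of degrees 1, 1, 4, 4 that
  already suffice, so a minimal one consists of exactly these. A proper subset of
  \<open>range gen\<close> has too few elements to contain them.\<close>

lemma minimal_generator_degrees_gen:
  "minimal_generator_degrees (range (poly_eval gen)) {#1, 1, 4, 4#}"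
  unfolding minimal_generator_degrees_def
proof (intro conjI allI impI exI)
  show "homogeneous_minimal_generating_set (range (poly_eval gen)) (range gen)"
    unfolding homogeneous_minimal_generating_set_def
  proof (intro conjI ballI allI impI)
    have hom: "\<exists>d. homogeneous d b" if "b \<in> range gen" for b
      using that homogeneous_gen unfolding homogeneous_eq_whomogeneous by blast
    then show "\<exists>d. homogeneous d b" if "b \<in> range gen" for b
      using that .
    show "subalgebra hull range gen = range (poly_eval gen)"
      by (simp add: range_poly_eval)
    fix C assume C: "C \<subset> range gen"
    show "subalgebra hull C \<noteq> range (poly_eval gen)"
    proof
      assume "subalgebra hull C = range (poly_eval gen)"
      then obtain b1 b2 b3 b4 where b: "{b1, b2, b3, b4} \<subseteq> C" "distinct [b1, b2, b3, b4]"
        by (rule homogeneous_generators) (use C hom in blast)+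
      have fin: "finite (range gen)" by (simp add: range_gen)
      then have "card (set [b1, b2, b3, b4]) \<le> card C"
        using b(1) C by (intro card_mono) (auto intro: finite_subset)
      then have "4 \<le> card C"
        using distinct_card[OF b(2)] by simp
      also have "card C < card (range gen)"
        by (rule psubset_card_mono[OF fin C])
      also have "card (range gen) \<le> card {X1, X2, Y1, Y2}"
        unfolding UNIV_xy_var by (rule card_image_le) simp
      finally show False by simp
    qed
  qed
next
  fix B assume "homogeneous_minimal_generating_set (range (poly_eval gen)) B"
  then have hom: "\<And>b. b \<in> B \<Longrightarrow> \<exists>d. homogeneous d b" and gen: "subalgebra hull B = range (poly_eval gen)"
    and min: "\<And>C. C \<subset> B \<Longrightarrow> subalgebra hull C \<noteq> range (poly_eval gen)"
    unfolding homogeneous_minimal_generating_set_def by blast+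
  obtain b1 b2 b3 b4 where b: "{b1, b2, b3, b4} \<subseteq> B" "distinct [b1, b2, b3, b4]" "0 \<notin> {b1, b2, b3, b4}"
    "homogeneous 1 b1" "homogeneous 1 b2" "homogeneous 4 b3" "homogeneous 4 b4"
    "subalgebra hull {b1, b2, b3, b4} = range (poly_eval gen)"
    using gen hom by (rule homogeneous_generators)
  then have B: "B = {b1, b2, b3, b4}"
    using min by blast
  then show "finite B" by simp
  have "mset_set B = {#b1, b2, b3, b4#}"
    using b(2) by (simp add: B)
  then show "image_mset total_degree (mset_set B) = {#1, 1, 4, 4#}"
    using b by (simp add: total_degree_eq)
qed

section \<open>The square of the ideal of positive-degree invariants\<close>

lemma ideal_prod_0:
  "0 \<in> positive_invariants_squared G" if "0 \<in> invariants G"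
proof -
  have "0 \<in> positive_invariants G"
    using that by (simp add: positive_invariants_def)
  \<comment> \<open>\<open>ideal_prod\<close> is generated by products and binary sums, so the empty
    sum has to be obtained as a product.\<close>
  then have "0 \<otimes>\<^bsub>invariant_ring G\<^esub> 0 \<in> positive_invariants_squared G"
    unfolding positive_invariants_squared_def by (intro ideal_prod.prod)
  then show ?thesis by (simp add: invariant_ring_def)
qed

lemma positive_invariants_squared_sum:
  assumes "0 \<in> invariants G" "\<And>i. i \<in> I \<Longrightarrow> f i \<in> positive_invariants_squared G"
  shows "sum f I \<in> positive_invariants_squared G"
  using assms(2)
proof (induction I rule: infinite_finite_induct)
  case (insert i I)
  then have "f i \<oplus>\<^bsub>invariant_ring G\<^esub> sum f I \<in> positive_invariants_squared G"
    unfolding positive_invariants_squared_def by (intro ideal_prod.sum) simp_all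
  with insert show ?case by (simp add: invariant_ring_def)
qed (simp_all add: ideal_prod_0[OF assms(1)])

text \<open>The generators have degree at most 4, so an invariant of larger degree involves only
  monomials in them with at least two factors.\<close>

lemma homogeneous_in_positive_invariants_squared:
  assumes inv: "invariants G = range (poly_eval gen)"
    and f: "f \<in> invariants G" "homogeneous d f" "4 < d"
  shows "f \<in> positive_invariants_squared G"
proof -
  let ?\<Phi> = "poly_eval gen"
  obtain c where c: "f = ?\<Phi> c"
    using f inv by auto
  have wc: "whomogeneous degs d c"
    using f(2) by (simp add: c whomogeneous_if_homogeneous)
  have pos: "?\<Phi> p \<in> positive_invariants G" if "whomogeneous degs e p" "0 < e" for e p
    using poly_eval_gen_homogeneous[OF that(1)] that(2) inv
    by (auto simp: positive_invariants_def homogeneous_def)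
  have "?\<Phi> (single m (lookup c m)) \<in> positive_invariants_squared G" if "m \<in> keys c" for m
  proof -
    have m: "weight degs m = d"
      using wc that by (simp add: whomogeneous_def)
    with f(3) have "keys m \<noteq> {}"
      by (auto simp: weight_def)
    then obtain v where "v \<in> keys m" by blast
    then have v: "lookup m v \<noteq> 0"
      by (simp add: in_keys_iff)
    define n where "n = m - single v 1"
    have mn: "m = single v 1 + n"
      using v by (intro poly_mapping_eqI) (auto simp: n_def lookup_add lookup_minus lookup_single when_def)
    \<comment> \<open>One variable uses at most 4 of the degree \<open>d > 4\<close>, so the
      cofactor still has positive degree.\<close>
    have "degs v \<le> 4" "0 < degs v" by (cases v; simp)+
    with m mn f(3) have "0 < weight degs n"
      by (simp add: weight_add weight_single)
    then have "?\<Phi> (single n (lookup c m)) \<in> positive_invariants G"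
      by (rule pos[OF whomogeneous_single[OF refl]])
    moreover have "?\<Phi> (var v) \<in> positive_invariants G"
      by (rule pos[OF whomogeneous_var \<open>0 < degs v\<close>])
    ultimately have "?\<Phi> (var v) \<otimes>\<^bsub>invariant_ring G\<^esub> ?\<Phi> (single n (lookup c m)) \<in> positive_invariants_squared G"
      unfolding positive_invariants_squared_def by (intro ideal_prod.prod)
    moreover have "single m (lookup c m) = var v * single n (lookup c m)"
      by (simp add: mn var_def mult_single)
    ultimately show ?thesis
      by (simp add: invariant_ring_def poly_eval_mult)
  qed
  moreover have "0 \<in> invariants G"
    using inv hom_0[OF poly_eval_hom, of gen] by (metis rangeI)
  ultimately have "(\<Sum>m\<in>keys c. ?\<Phi> (single m (lookup c m))) \<in> positive_invariants_squared G"
    by (intro positive_invariants_squared_sum)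
  then show ?thesis
    by (simp add: c poly_mapping_sum_keys flip: poly_eval_sum)
qed

section \<open>The group and its orbits\<close>

lemma graded_automorphism_iff:
  "graded_automorphism \<phi> \<longleftrightarrow>
     bij \<phi> \<and> algebra_hom \<phi> \<and> (\<forall>d f. homogeneous d f \<longrightarrow> homogeneous d (\<phi> f))"
  unfolding graded_automorphism_def algebra_hom_def by blast

text \<open>Homogeneity of the inverse is the nontrivial part: \<phi> is an injective evaluation at
  linear forms, and such evaluations reflect homogeneity.\<close>

lemma graded_automorphism_inv:
  assumes "graded_automorphism \<phi>"
  shows "graded_automorphism (inv_into UNIV \<phi>)"
proof -
  have \<phi>: "bij \<phi>" "algebra_hom \<phi>" "\<And>d f. homogeneous d f \<Longrightarrow> homogeneous d (\<phi> f)"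
    using assms by (auto simp: graded_automorphism_iff)
  let ?\<psi> = "inv_into UNIV \<phi>"
  have \<phi>\<psi>: "\<phi> (?\<psi> f) = f" for f
    using \<phi>(1) by (simp add: bij_is_surj surj_f_inv_f)
  have eqI: "f = g" if "\<phi> f = \<phi> g" for f g
    using \<phi>(1) that by (meson bij_is_inj injD)
  have "bij ?\<psi>"
    by (rule bij_imp_bij_inv[OF \<phi>(1)])
  moreover have "algebra_hom ?\<psi>"
    unfolding algebra_hom_def
    by (intro conjI allI; rule eqI)
      (simp_all add: \<phi>\<psi> hom_add[OF \<phi>(2)] hom_mult[OF \<phi>(2)] hom_const[OF \<phi>(2)])
  moreover have "homogeneous d (?\<psi> f)" if "homogeneous d f" for d f
  proof -
    have eval: "\<phi> = poly_eval (\<lambda>v. \<phi> (var v))"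
      by (rule ext) (rule hom_eq_poly_eval[OF \<phi>(2)])
    have inj: "inj (poly_eval (\<lambda>v. \<phi> (var v)))"
      unfolding eval[symmetric] by (rule bij_is_inj[OF \<phi>(1)])
    have s: "whomogeneous (\<lambda>_. 1) 1 (\<phi> (var v))" for v
      by (rule \<phi>(3)[of 1 "var v", unfolded homogeneous_eq_whomogeneous]) (rule whomogeneous_var)
    have "whomogeneous (\<lambda>_. 1) d (poly_eval (\<lambda>v. \<phi> (var v)) (?\<psi> f))"
      using that unfolding eval[symmetric] \<phi>\<psi> homogeneous_eq_whomogeneous .
    from whomogeneous_if_poly_eval[OF inj s this]
    show ?thesis unfolding homogeneous_eq_whomogeneous .
  qed
  ultimately show ?thesis by (simp add: graded_automorphism_iff)
qed

lemma graded_aut_group_simps [simp]: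
  "carrier graded_aut_group = {\<phi>. graded_automorphism \<phi>}"
  "monoid.mult graded_aut_group = (\<circ>)" "one graded_aut_group = id"
  by (simp_all add: graded_aut_group_def)

lemma group_graded_aut_group: "group graded_aut_group"
proof (rule groupI, goal_cases)
  case (1 \<phi> \<psi>)
  then show ?case
    by (simp add: graded_automorphism_iff bij_comp algebra_hom_comp)
next
  case 2
  show ?case
    by (simp add: graded_automorphism_iff algebra_hom_id)
next
  case (5 \<phi>)
  then have "graded_automorphism (inv_into UNIV \<phi>)" "inv_into UNIV \<phi> \<circ> \<phi> = id"
    using graded_automorphism_inv by (auto simp: graded_automorphism_iff bij_is_inj)
  then show ?case by auto
qed (simp_all add: comp_assoc)

lemma S_hom_eqI:
  assumes "algebra_hom \<phi>" "algebra_hom \<psi>"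
    "\<phi> x1 = \<psi> x1" "\<phi> x2 = \<psi> x2" "\<phi> y1 = \<psi> y1" "\<phi> y2 = \<psi> y2"
  shows "\<phi> = \<psi>"
proof
  fix f
  have "\<phi> (var v) = \<psi> (var v)" for v
    using assms(3-) by (cases v) (simp_all add: x1_def x2_def y1_def y2_def)
  then show "\<phi> f = \<psi> f"
    by (rule hom_ext[OF assms(1,2)])
qed

lemma transl_simps [simp]:
  "transl a b c d x1 = x1" "transl a b c d x2 = x2"
  "transl a b c d y1 = y1 + lin a b" "transl a b c d y2 = y2 + lin c d"
  by (simp_all add: transl_def)

lemma transl_comp: "transl a b c d \<circ> transl a' b' c' d' = transl (a + a') (b + b') (c + c') (d + d')"
  by (rule S_hom_eqI)
    (simp_all add: algebra_hom_comp transl_hom hom_add[OF transl_hom] transl_lin add.assoc lin_add)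

lemma transl_0: "transl 0 0 0 0 = id"
  by (rule S_hom_eqI) (simp_all add: transl_hom algebra_hom_id lin_0)

lemma lookup_lin: "lookup (lin a b) (single X1 1) = a" "lookup (lin a b) (single X2 1) = b"
  using single_neq[of X1 X2]
  by (simp_all add: lin_def x1_def x2_def var_def lookup_add lookup_const_mult lookup_single del: One_nat_def)

lemma lin_eq_0_iff: "lin a b = 0 \<longleftrightarrow> a = 0 \<and> b = 0"
  using lookup_lin[of a b] by (auto simp: lin_0)

lemma transl_eq_id_iff: "transl a b c d = id \<longleftrightarrow> a = 0 \<and> b = 0 \<and> c = 0 \<and> d = 0"
proof
  assume "transl a b c d = id"
  then have "transl a b c d y1 = y1" "transl a b c d y2 = y2" by simp_all
  then show "a = 0 \<and> b = 0 \<and> c = 0 \<and> d = 0"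
    by (simp add: lin_eq_0_iff)
qed (simp add: transl_0)

lemma whomogeneous_lin: "whomogeneous (\<lambda>_. 1) 1 (lin a b)"
  unfolding lin_def x1_def x2_def
  by (intro whomogeneous_add whomogeneous_const_mult whomogeneous_var)

lemma graded_automorphism_transl: "graded_automorphism (transl a b c d)"
  unfolding graded_automorphism_iff
proof (intro conjI allI impI)
  have "transl a b c d \<circ> transl a b c d = id"
    by (simp add: transl_comp f8_add_self transl_0)
  then show "bij (transl a b c d)" by (rule o_bij) fact
  fix e and f :: S assume f: "homogeneous e f"
  have "whomogeneous (\<lambda>_. 1) 1 (var w + lin a b)" for w a b
    by (intro whomogeneous_add whomogeneous_lin whomogeneous_var)
  then have "whomogeneous (\<lambda>_. 1) 1 (transl a b c d (var v))" for v
    using transl_simps[of a b c d] whomogeneous_var[of "\<lambda>_. 1" v, where ?'b = f8]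
    unfolding x1_def x2_def y1_def y2_def by (cases v) simp_all
  from whomogeneous_poly_eval[OF this, where f = f and e = e]
  show "homogeneous e (transl a b c d f)"
    using f hom_eq_poly_eval[OF transl_hom, of a b c d f] by (simp add: homogeneous_eq_whomogeneous)
qed (rule transl_hom)

section \<open>The identification with C_2^4\<close>

abbreviation (input) C2_4 :: "(nat \<Rightarrow> int) monoid" where
  "C2_4 \<equiv> product_group {..<4} (\<lambda>_. integer_mod_group 2)"

text \<open>The product of the powers of \<sigma>1, ..., \<sigma>4 with exponents
  \<open>k 0\<close>, ..., \<open>k 3\<close>, written as one translation by adding the four
  translation vectors.\<close>

definition act :: "(nat \<Rightarrow> int) \<Rightarrow> S \<Rightarrow> S" where
  "act k = (let c = (\<lambda>i. of_int (k i)); \<beta> = 1 + \<alpha>^2 in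
     transl (c 0 + \<beta> * (c 2 + c 3)) (c 2 + \<alpha>^2 * c 3) (\<alpha> * c 2 + \<beta> * c 3) (c 1 + \<alpha>^2 * (c 2 + c 3)))"

lemma carrier_C2_4: "k \<in> carrier C2_4 \<longleftrightarrow> k \<in> extensional {..<4} \<and> (\<forall>i<4. k i \<in> {0, 1})"
proof -
  have "{0..<2 :: int} = {0, 1}" by auto
  then show ?thesis
    by (auto simp: carrier_integer_mod_group PiE_iff)
qed

lemma of_int_add_mod_2: "of_int ((a + b) mod 2) = (of_int a + of_int b :: f8)"
proof -
  have "of_int (a + b) = (of_int ((a + b) mod 2 + 2 * ((a + b) div 2)) :: f8)"
    by (simp only: mod_mult_div_eq)
  also have "\<dots> = of_int ((a + b) mod 2)"
    by (simp only: mult_2 of_int_add f8_add_self add_0_right)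
  finally show ?thesis
    by (simp only: of_int_add)
qed

lemma act_hom: "act \<in> hom C2_4 graded_aut_group"
proof (rule homI)
  fix k l assume "k \<in> carrier C2_4" "l \<in> carrier C2_4"
  have "of_int ((k \<otimes>\<^bsub>C2_4\<^esub> l) i) = (of_int (k i) + of_int (l i) :: f8)" if "i < 4" for i
    using that by (simp add: of_int_add_mod_2 del: of_int_add)
  then show "act (k \<otimes>\<^bsub>C2_4\<^esub> l) = act k \<otimes>\<^bsub>graded_aut_group\<^esub> act l"
    unfolding act_def Let_def by (simp add: transl_comp algebra_simps del: mult_product_group)
qed (simp add: act_def Let_def graded_automorphism_transl)

lemma group_hom_act: "group_hom C2_4 graded_aut_group act"
  by (simp add: group_hom_def group_hom_axioms_def group_graded_aut_group act_hom)

text \<open>Writing the image of \<open>act\<close> as words in the generators places it in the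
  generated subgroup and reduces invariance to the four generators.\<close>

lemma act_decomp:
  assumes "k \<in> carrier C2_4"
  obtains f g h j where "act k = f \<circ> g \<circ> h \<circ> j" "f \<in> {id, \<sigma>1}" "g \<in> {id, \<sigma>2}" "h \<in> {id, \<sigma>3}" "j \<in> {id, \<sigma>4}"
proof -
  define b where "b i = (of_int (k i) :: f8)" for i
  have "b i = 0 \<or> b i = 1" if "i < 4" for i
  proof -
    have "k i = 0 \<or> k i = 1"
      using assms that unfolding carrier_C2_4 by blast
    then show ?thesis by (auto simp: b_def)
  qed
  then have b: "b 0 = 0 \<or> b 0 = 1" "b 1 = 0 \<or> b 1 = 1" "b 2 = 0 \<or> b 2 = 1" "b 3 = 0 \<or> b 3 = 1"
    by simp_all
  have "act k = transl (b 0) 0 0 0 \<circ> transl 0 0 0 (b 1) \<circ>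
      transl ((1 + \<alpha>^2) * b 2) (b 2) (\<alpha> * b 2) (\<alpha>^2 * b 2) \<circ>
      transl ((1 + \<alpha>^2) * b 3) (\<alpha>^2 * b 3) ((1 + \<alpha>^2) * b 3) (\<alpha>^2 * b 3)"
    by (simp add: act_def Let_def transl_comp b_def algebra_simps)
  moreover have "transl (b 0) 0 0 0 \<in> {id, \<sigma>1}"
    using b(1) by (elim disjE; simp add: \<sigma>_eq_transl transl_0)
  moreover have "transl 0 0 0 (b 1) \<in> {id, \<sigma>2}"
    using b(2) by (elim disjE; simp add: \<sigma>_eq_transl transl_0)
  moreover have "transl ((1 + \<alpha>^2) * b 2) (b 2) (\<alpha> * b 2) (\<alpha>^2 * b 2) \<in> {id, \<sigma>3}"
    using b(3) by (elim disjE; simp add: \<sigma>_eq_transl transl_0)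
  moreover have "transl ((1 + \<alpha>^2) * b 3) (\<alpha>^2 * b 3) ((1 + \<alpha>^2) * b 3) (\<alpha>^2 * b 3) \<in> {id, \<sigma>4}"
    using b(4) by (elim disjE; simp add: \<sigma>_eq_transl transl_0)
  ultimately show ?thesis by (rule that)
qed

text \<open>The coefficient of \<open>x2\<close> in the shift of \<open>y1\<close> is
  \<open>k 2\<close> plus \<alpha>^2 times \<open>k 3\<close>. As 1 and \<alpha>^2 are independent
  over F_2, both exponents vanish; then the other coordinates give \<open>k 0\<close> and
  \<open>k 1\<close>.\<close>

lemma act_eq_id:
  assumes "k \<in> carrier C2_4" "act k = id"
  shows "k = \<one>\<^bsub>C2_4\<^esub>"
proof -
  have ext: "k \<in> extensional {..<4}"
    using assms(1) unfolding carrier_C2_4 by blast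
  have ki: "k i = 0 \<or> k i = 1" if "i < 4" for i
    using assms(1) that unfolding carrier_C2_4 by blast
  from ki[of 0] ki[of 1] ki[of 2] ki[of 3]
  have ki: "k 0 = 0 \<or> k 0 = 1" "k 1 = 0 \<or> k 1 = 1" "k 2 = 0 \<or> k 2 = 1" "k 3 = 0 \<or> k 3 = 1"
    by simp_all
  have eqs: "of_int (k 0) + (1 + \<alpha>^2) * (of_int (k 2) + of_int (k 3)) = (0 :: f8)"
    "of_int (k 2) + \<alpha>^2 * of_int (k 3) = (0 :: f8)"
    "of_int (k 1) + \<alpha>^2 * (of_int (k 2) + of_int (k 3)) = (0 :: f8)"
    using assms(2) unfolding act_def Let_def transl_eq_id_iff by blast+
  have \<alpha>: "\<alpha>^2 = F8 0 0 1" "1 + \<alpha>^2 = F8 1 0 1"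
    by (simp_all add: f8_arith)
  have "k 3 = 0"
    using ki(3,4) eqs(2) unfolding \<alpha> by (elim disjE) (simp_all add: one_f8_def zero_f8_def)
  moreover from this have "k 2 = 0"
    using ki(3) eqs(2) by (elim disjE) simp_all
  moreover from calculation have "k 0 = 0"
    using ki(1) eqs(1) by (elim disjE) simp_all
  moreover from calculation have "k 1 = 0"
    using ki(2) eqs(3) by (elim disjE) simp_all
  moreover have "i = 0 \<or> i = 1 \<or> i = 2 \<or> i = 3" if "i < 4" for i :: nat
    using that by arith
  ultimately have "k i = 0" if "i < 4" for i
    using that by metis
  then show ?thesis
    unfolding one_product_group one_integer_mod_group
    by (intro extensionalityI[OF ext restrict_extensional]) simp
qed

definition unit_vec :: "nat \<Rightarrow> nat \<Rightarrow> int" where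
  "unit_vec j = (\<lambda>i\<in>{..<4}. if i = j then 1 else 0)"

lemma unit_vec_carrier: "unit_vec j \<in> carrier C2_4"
  by (auto simp: carrier_C2_4 unit_vec_def)

lemma act_unit_vec: "act (unit_vec 0) = \<sigma>1" "act (unit_vec 1) = \<sigma>2" "act (unit_vec 2) = \<sigma>3" "act (unit_vec 3) = \<sigma>4"
  by (simp_all add: act_def Let_def unit_vec_def \<sigma>_eq_transl)

definition GG :: "(xy_var, f8) aut_monoid" where
  "GG = subgroup_generated graded_aut_group {\<sigma>1, \<sigma>2, \<sigma>3, \<sigma>4}"

lemma \<sigma>_graded: "{\<sigma>1, \<sigma>2, \<sigma>3, \<sigma>4} \<subseteq> carrier graded_aut_group"
  by (simp add: \<sigma>_eq_transl graded_automorphism_transl)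

lemma GG_simps: "monoid.mult GG = (\<circ>)" "one GG = id"
  by (simp_all add: GG_def subgroup_generated_def)

lemma group_GG: "group GG"
  unfolding GG_def by (rule group.group_subgroup_generated[OF group_graded_aut_group])

lemma subgroup_GG: "subgroup (carrier GG) graded_aut_group"
  unfolding GG_def by (rule group.subgroup_subgroup_generated[OF group_graded_aut_group])

lemma \<sigma>_in_GG: "{\<sigma>1, \<sigma>2, \<sigma>3, \<sigma>4} \<subseteq> carrier GG"
  unfolding GG_def by (rule group.subgroup_generated_subset_carrier_subset[OF group_graded_aut_group \<sigma>_graded])

lemma carrier_GG: "carrier GG = act ` carrier C2_4"
proof
  have "{\<sigma>1, \<sigma>2, \<sigma>3, \<sigma>4} \<subseteq> act ` carrier C2_4"
    unfolding act_unit_vec [symmetric] using unit_vec_carrier by blast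
  moreover have "subgroup (act ` carrier C2_4) graded_aut_group"
    by (rule group_hom.img_is_subgroup[OF group_hom_act])
  ultimately show "carrier GG \<subseteq> act ` carrier C2_4"
    unfolding GG_def by (intro group.subgroup_generated_minimal[OF group_graded_aut_group])
  show "act ` carrier C2_4 \<subseteq> carrier GG"
  proof clarify
    fix k assume "k \<in> carrier C2_4"
    then obtain f g h j where k: "act k = f \<circ> g \<circ> h \<circ> j" "f \<in> {id, \<sigma>1}" "g \<in> {id, \<sigma>2}" "h \<in> {id, \<sigma>3}" "j \<in> {id, \<sigma>4}"
      by (rule act_decomp)
    have comp: "p \<circ> q \<in> carrier GG" if "p \<in> carrier GG" "q \<in> carrier GG" for p q
      using subgroup.m_closed[OF subgroup_GG that] by simp
    have "id \<in> carrier GG"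
      using subgroup.one_closed[OF subgroup_GG] by simp
    with k(2-5) \<sigma>_in_GG have "f \<in> carrier GG" "g \<in> carrier GG" "h \<in> carrier GG" "j \<in> carrier GG"
      by blast+
    then show "act k \<in> carrier GG"
      unfolding k(1) by (intro comp)
  qed
qed

lemma group_hom_act_GG: "group_hom C2_4 GG act"
proof -
  have "act \<in> hom C2_4 GG"
    using act_hom carrier_GG by (auto simp: hom_def GG_simps)
  then show ?thesis
    by (simp add: group_hom_def group_hom_axioms_def group_GG)
qed

lemma act_iso: "act \<in> iso C2_4 GG"
  unfolding group_hom.iso_iff[OF group_hom_act_GG] using act_eq_id by (simp add: carrier_GG GG_simps)

lemma GG_iso: "GG \<cong> C2_4"
proof (rule group.iso_sym)
  show "C2_4 \<cong> GG" using act_iso by (auto simp: is_iso_def)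
qed simp

lemma finite_GG: "finite (carrier GG)"
  unfolding carrier_GG by (simp add: finite_PiE carrier_integer_mod_group)

lemma order_GG: "order GG = 16"
proof -
  have "bij_betw act (carrier C2_4) (carrier GG)"
    using act_iso by (simp add: iso_def)
  then have "order GG = card (carrier C2_4)"
    by (simp add: order_def bij_betw_same_card)
  also have "\<dots> = 16"
    by (simp add: card_PiE carrier_integer_mod_group)
  finally show ?thesis .
qed

lemma fixed_by_GG_iff: "fixed_by GG f \<longleftrightarrow> \<sigma>1 f = f \<and> \<sigma>2 f = f \<and> \<sigma>3 f = f \<and> \<sigma>4 f = f"
proof
  assume "fixed_by GG f"
  then show "\<sigma>1 f = f \<and> \<sigma>2 f = f \<and> \<sigma>3 f = f \<and> \<sigma>4 f = f"
    using \<sigma>_in_GG by (auto simp: fixed_by_def)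
next
  assume \<sigma>: "\<sigma>1 f = f \<and> \<sigma>2 f = f \<and> \<sigma>3 f = f \<and> \<sigma>4 f = f"
  show "fixed_by GG f"
    unfolding fixed_by_def carrier_GG
  proof clarify
    fix k assume "k \<in> carrier C2_4"
    then obtain p q r s where "act k = p \<circ> q \<circ> r \<circ> s" "p \<in> {id, \<sigma>1}" "q \<in> {id, \<sigma>2}" "r \<in> {id, \<sigma>3}" "s \<in> {id, \<sigma>4}"
      by (rule act_decomp)
    with \<sigma> show "act k f = f" by auto
  qed
qed

lemma invariants_GG: "invariants GG = range (poly_eval gen)"
proof -
  have "fixed_by GG f" if "f \<in> range (poly_eval gen)" for f
    using that unfolding fixed_by_GG_iff range_poly_eval
    by (auto intro!: fixed_on_hull[of _ "range gen" f] simp: \<sigma>_hom \<sigma>_fixes_gen)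
  moreover have "f \<in> range (poly_eval gen)" if "fixed_by GG f" for f
    using that \<sigma>_invariant_in_hull by (simp add: fixed_by_GG_iff range_poly_eval range_gen)
  ultimately show ?thesis
    by (auto simp: invariant_ring_def)
qed

lemma bij_GG: "g \<in> carrier GG \<Longrightarrow> bij g"
  using subgroup.subset[OF subgroup_GG] by (auto simp: graded_automorphism_iff)

lemma faithful_GG: "faithful_action GG UNIV (\<lambda>g. g)"
proof -
  have "(\<lambda>g. g) \<in> hom GG (BijGroup UNIV)"
    using bij_GG by (auto simp: hom_def BijGroup_def Bij_def GG_simps compose_def comp_def)
  then have "group_hom GG (BijGroup UNIV) (\<lambda>g. g)"
    by (simp add: group_hom_def group_hom_axioms_def group_GG group_BijGroup)
  then show ?thesis
    by (simp add: faithful_action_def group_action_def faithful_action_axioms_def)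
qed

lemma modular_GG: "modular_group GG"
  unfolding modular_group_def
proof (intro conjI)
  show "\<exists>H. subgroup H graded_aut_group \<and> GG = graded_aut_group\<lparr>carrier := H\<rparr>"
    using subgroup_GG by (intro exI[of _ "carrier GG"]) (simp add: GG_def subgroup_generated_def)
  have "CHAR(f8) = 2"
  proof (rule CHAR_eq_posI)
    fix n :: nat assume "0 < n" "n < 2"
    then have "n = 1" by simp
    then show "of_nat n \<noteq> (0 :: f8)" by simp
  qed (simp_all add: numeral_2_eq_2 f8_add_self)
  then show "CHAR(f8) dvd order GG" by (simp add: order_GG)
qed (rule finite_GG)

lemma group_action_GG: "group_action GG UNIV (\<lambda>g. g)"
  using faithful_GG by (simp add: faithful_action_def)

section \<open>Orbits of linear forms\<close>

lemma transl_linear_form: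
  "transl p q r s (lin a b + const c * y1 + const e * y2) =
     lin a b + const c * y1 + const e * y2 + lin (c * p + e * r) (c * q + e * s)"
  unfolding hom_add[OF transl_hom] hom_mult[OF transl_hom] hom_const[OF transl_hom]
    transl_lin transl_simps distrib_left const_mult_lin lin_add [symmetric]
  by (simp only: add_ac)

text \<open>The displacement of a linear form with y-part \<open>c * y1 + e * y2\<close>, as a
  coefficient pair. Taking a tuple of bits as argument makes it executable.\<close>

definition shift :: "f8 \<Rightarrow> f8 \<Rightarrow> f8 \<times> f8 \<times> f8 \<times> f8 \<Rightarrow> f8 \<times> f8" where
  "shift c e = (\<lambda>(d0, d1, d2, d3).
     (c * (d0 + (1 + \<alpha>^2) * (d2 + d3)) + e * (\<alpha> * d2 + (1 + \<alpha>^2) * d3),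
      c * (d2 + \<alpha>^2 * d3) + e * (d1 + \<alpha>^2 * (d2 + d3))))"

abbreviation bits_of :: "(nat \<Rightarrow> int) \<Rightarrow> f8 \<times> f8 \<times> f8 \<times> f8" where
  "bits_of k \<equiv> (of_int (k 0), of_int (k 1), of_int (k 2), of_int (k 3))"

lemma act_linear_form:
  "act k (lin a b + const c * y1 + const e * y2) = lin a b + const c * y1 + const e * y2 +
     lin (fst (shift c e (bits_of k))) (snd (shift c e (bits_of k)))"
  unfolding act_def Let_def transl_linear_form shift_def by simp

lemma linear_form_eq:
  assumes "linear_form l"
  shows "\<exists>a b c e. l = lin a b + const c * y1 + const e * y2"
proof -
  have l: "whomogeneous (\<lambda>_. 1) 1 l"
    using assms by (simp add: linear_form_def homogeneous_eq_whomogeneous)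
  have "m \<in> range (\<lambda>v. single v 1)" if "m \<in> keys l" for m
  proof -
    have "weight (\<lambda>_. 1) m = 1"
      using l that by (simp add: whomogeneous_def)
    then have sum: "lookup m X1 + lookup m X2 + lookup m Y1 + lookup m Y2 = 1"
      by (simp add: weight_xy)
    then have "m \<noteq> 0" by auto
    then obtain v where v: "lookup m v \<noteq> 0"
      by (metis lookup_zero poly_mapping_eqI)
    have "lookup m w = lookup (single v 1) w" for w
      using sum v by (cases v; cases w) (simp_all add: lookup_single)
    then have "m = single v 1" by (rule poly_mapping_eqI)
    then show ?thesis by blast
  qed
  then have "keys l \<subseteq> {single X1 1, single X2 1, single Y1 1, single Y2 1}"
    by (auto simp: UNIV_xy_var)
  then have "l = (\<Sum>m\<in>{single X1 1, single X2 1, single Y1 1, single Y2 1}. single m (lookup l m))"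
    by (intro poly_mapping_sum_superset[symmetric]) simp_all
  also have "\<dots> = lin (lookup l (single X1 1)) (lookup l (single X2 1)) +
      const (lookup l (single Y1 1)) * y1 + const (lookup l (single Y2 1)) * y2"
    using single_neq[of X1 X2] single_neq[of X1 Y1] single_neq[of X1 Y2] single_neq[of X2 Y1]
      single_neq[of X2 Y2] single_neq[of Y1 Y2]
    by (simp add: single_eq_const_mult_var lin_def x1_def x2_def y1_def y2_def add.assoc del: One_nat_def)
  finally show ?thesis by blast
qed

definition f8_list :: "f8 list" where
  "f8_list = [F8 a b c. a \<leftarrow> [0, 1], b \<leftarrow> [0, 1], c \<leftarrow> [0, 1]]"

definition bits :: "(f8 \<times> f8 \<times> f8 \<times> f8) list" where
  "bits = [(a, b, c, d). a \<leftarrow> [0, 1], b \<leftarrow> [0, 1], c \<leftarrow> [0, 1], d \<leftarrow> [0, 1]]"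

lemma set_f8_list: "set f8_list = UNIV"
proof -
  have "x \<in> set f8_list" for x
  proof (cases x)
    case (F8 a b c)
    then show ?thesis
      by (cases a; cases b; cases c) (simp_all add: f8_list_def)
  qed
  then show ?thesis by blast
qed

text \<open>On bits, \<open>shift c e\<close> is an F_2-linear map from F_2^4 to F_8^2, and the
  claim is that its rank is at least 3. It is evaluated for all 63 nonzero pairs and 16 bit
  vectors.\<close>

lemma shift_kernel_aux:
  "\<forall>c\<in>set f8_list. \<forall>e\<in>set f8_list. (c, e) \<noteq> (0, 0) \<longrightarrow> length (filter (\<lambda>d. shift c e d = (0, 0)) bits) \<le> 2"
  by code_simp

lemma card_shift_kernel:
  assumes "c \<noteq> 0 \<or> e \<noteq> 0"
  shows "card {k \<in> carrier C2_4. shift c e (bits_of k) = (0, 0)} \<le> 2" (is "card ?K \<le> 2")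
proof -
  have bit: "k i = 0 \<or> k i = 1" if "k \<in> carrier C2_4" "i < 4" for k i
    using that unfolding carrier_C2_4 by blast
  have "inj_on bits_of (carrier C2_4)"
  proof (rule inj_onI)
    fix k l assume k: "k \<in> carrier C2_4" and l: "l \<in> carrier C2_4" and eq: "bits_of k = bits_of l"
    have "k i = l i" if "i < 4" for i
    proof -
      have "i = 0 \<or> i = 1 \<or> i = 2 \<or> i = 3"
        using that by arith
      with eq have "(of_int (k i) :: f8) = of_int (l i)"
        unfolding prod.inject by metis
      with bit[OF k that] bit[OF l that] show ?thesis
        by (elim disjE) simp_all
    qed
    then have agree: "k i = l i" if "i \<in> {..<4}" for i
      using that by (simp only: lessThan_iff)
    have "k \<in> extensional {..<4}" "l \<in> extensional {..<4}"
      using k l unfolding carrier_C2_4 by blast+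
    then show "k = l"
      by (rule extensionalityI) (rule agree)
  qed
  then have "card ?K = card (bits_of ` ?K)"
    by (rule card_image[symmetric, OF inj_on_subset]) blast
  also have "\<dots> \<le> card (set (filter (\<lambda>d. shift c e d = (0, 0)) bits))"
  proof (rule card_mono)
    have "bits_of k \<in> set bits" if "k \<in> carrier C2_4" for k
    proof -
      have of_int_bit: "(of_int (k i) :: f8) = 0 \<or> (of_int (k i) :: f8) = 1" if "i < 4" for i
        using bit[OF \<open>k \<in> carrier C2_4\<close> that] by (elim disjE) simp_all
      have "(of_int (k 0) :: f8) = 0 \<or> (of_int (k 0) :: f8) = 1" "(of_int (k 1) :: f8) = 0 \<or> (of_int (k 1) :: f8) = 1"
        "(of_int (k 2) :: f8) = 0 \<or> (of_int (k 2) :: f8) = 1" "(of_int (k 3) :: f8) = 0 \<or> (of_int (k 3) :: f8) = 1"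
        by (rule of_int_bit, simp)+
      then show ?thesis
        unfolding bits_def by (elim disjE) simp_all
    qed
    then show "bits_of ` ?K \<subseteq> set (filter (\<lambda>d. shift c e d = (0, 0)) bits)"
      unfolding set_filter by blast
  qed simp
  also have "\<dots> \<le> length (filter (\<lambda>d. shift c e d = (0, 0)) bits)"
    by (rule card_length)
  also have "\<dots> \<le> 2"
    by (rule shift_kernel_aux[unfolded set_f8_list, rule_format]) (use assms in simp_all)
  finally show ?thesis .
qed

text \<open>A form without y-part is fixed, so \<open>(c, e)\<close> is nonzero and the stabilizer
  has at most two elements. Orbit-stabilizer with group order 16 leaves the sizes 16 and 8.\<close>

lemma card_orbit:
  assumes l: "linear_form l" "\<not> fixed_by GG l"
  shows "card (orbit_of GG l) \<in> {8, 16}"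
proof -
  obtain a b c e where l_eq: "l = lin a b + const c * y1 + const e * y2"
    using linear_form_eq[OF l(1)] by blast
  have act_l: "act k l = l \<longleftrightarrow> shift c e (bits_of k) = (0, 0)" for k
    unfolding l_eq act_linear_form add_cancel_left_right lin_eq_0_iff by (simp add: prod_eq_iff)
  have "c \<noteq> 0 \<or> e \<noteq> 0"
  proof (rule ccontr)
    assume "\<not> (c \<noteq> 0 \<or> e \<noteq> 0)"
    then have "act k l = l" for k
      unfolding act_l by (simp add: shift_def)
    then have "fixed_by GG l"
      unfolding fixed_by_def carrier_GG by blast
    with l(2) show False ..
  qed
  have "stabilizer GG (\<lambda>g. g) l = act ` {k \<in> carrier C2_4. shift c e (bits_of k) = (0, 0)}"
    unfolding stabilizer_def carrier_GG act_l [symmetric] by blast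
  also have "card \<dots> \<le> card {k \<in> carrier C2_4. shift c e (bits_of k) = (0, 0)}"
    by (rule card_image_le) (simp add: finite_PiE carrier_integer_mod_group)
  also have "\<dots> \<le> 2"
    by (rule card_shift_kernel) fact
  finally have "card (stabilizer GG (\<lambda>g. g) l) \<le> 2" .
  moreover have "card (orbit_of GG l) * card (stabilizer GG (\<lambda>g. g) l) = 16"
    using group_action.orbit_stabilizer_theorem[OF group_action_GG, of l] by (simp add: order_GG)
  moreover have "n = 0 \<or> n = 1 \<or> n = 2" if "n \<le> 2" for n :: nat
    using that by arith
  \<comment> \<open>The first case, an empty stabilizer, is contradictory.\<close>
  ultimately consider "card (orbit_of GG l) * 0 = 16" | "card (orbit_of GG l) * 1 = 16" | "card (orbit_of GG l) * 2 = 16"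
    by metis
  then show ?thesis by cases auto
qed

section \<open>Orbit norms\<close>

lemma hom_GG: "g \<in> carrier GG \<Longrightarrow> algebra_hom g"
  and graded_GG: "g \<in> carrier GG \<Longrightarrow> homogeneous d f \<Longrightarrow> homogeneous d (g f)"
  using subgroup.subset[OF subgroup_GG] by (auto simp: graded_automorphism_iff)

lemma finite_orbit_GG: "finite (orbit_of GG l)"
proof -
  have "orbit_of GG l = (\<lambda>g. g l) ` carrier GG"
    by (auto simp: orbit_def)
  then show ?thesis
    by (simp add: finite_GG)
qed

text \<open>A group element maps the finite orbit injectively into itself, hence permutes the
  factors of the norm.\<close>

lemma fixed_by_orbit_norm: "fixed_by GG (orbit_norm GG l)"
  unfolding fixed_by_def
proof
  fix g assume g: "g \<in> carrier GG"
  have "g ` orbit_of GG l \<subseteq> orbit_of GG l"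
  proof clarify
    fix f assume "f \<in> orbit_of GG l"
    then obtain h where h: "h \<in> carrier GG" "f = h l"
      by (auto simp: orbit_def)
    have "g \<circ> h \<in> carrier GG"
      using subgroup.m_closed[OF subgroup_GG g h(1)] by simp
    then show "g f \<in> orbit_of GG l"
      unfolding orbit_def h(2) by (auto intro!: exI[of _ "g \<circ> h"])
  qed
  moreover have inj: "inj_on g (orbit_of GG l)"
    using bij_GG[OF g] by (auto intro: inj_on_subset bij_is_inj)
  ultimately have "g ` orbit_of GG l = orbit_of GG l"
    by (intro endo_inj_surj finite_orbit_GG)
  then have "bij_betw g (orbit_of GG l) (orbit_of GG l)"
    using inj by (simp add: bij_betw_def)
  then show "g (orbit_norm GG l) = orbit_norm GG l"
    unfolding orbit_norm_def hom_prod[OF hom_GG[OF g]] by (rule prod.reindex_bij_betw)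
qed

lemma homogeneous_orbit_norm:
  assumes "linear_form l"
  shows "homogeneous (card (orbit_of GG l)) (orbit_norm GG l)"
proof -
  have "whomogeneous (\<lambda>_. 1) 1 f" if "f \<in> orbit_of GG l" for f
    using that assms graded_GG[of _ 1 l]
    unfolding orbit_def linear_form_def homogeneous_eq_whomogeneous by blast
  from whomogeneous_prod[of "orbit_of GG l" "\<lambda>_. 1" "\<lambda>_. 1" "\<lambda>f. f", OF this]
  show ?thesis
    by (simp add: orbit_norm_def homogeneous_eq_whomogeneous)
qed

text \<open>Zero is a fixed form, so it lies in no orbit of a nonfixed one. Being nonzero, the norm
  has the orbit size as its \<open>total_degree\<close>.\<close>

lemma orbit_norm_neq_0:
  assumes "\<not> fixed_by GG l"
  shows "orbit_norm GG l \<noteq> 0"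
proof -
  have "g l \<noteq> 0" if g: "g \<in> carrier GG" for g
  proof
    assume "g l = 0"
    then have "g l = g 0" by (simp add: hom_0[OF hom_GG[OF g]])
    then have "l = 0"
      using bij_is_inj[OF bij_GG[OF g]] by (rule injD[rotated])
    with assms show False
      by (simp add: fixed_by_def hom_0[OF hom_GG])
  qed
  then have "0 \<notin> orbit_of GG l"
    unfolding orbit_def by auto
  then show ?thesis
    by (simp add: orbit_norm_def prod_zero_iff[OF finite_orbit_GG])
qed

lemma orbit_norm_in_positive_invariants_squared:
  assumes "linear_form l" "\<not> fixed_by GG l"
  shows "orbit_norm GG l \<in> positive_invariants_squared GG"
proof (rule homogeneous_in_positive_invariants_squared[OF invariants_GG])
  show "orbit_norm GG l \<in> invariants GG"
    by (simp add: invariant_ring_def fixed_by_orbit_norm)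
  show "homogeneous (card (orbit_of GG l)) (orbit_norm GG l)"
    by (rule homogeneous_orbit_norm[OF assms(1)])
  show "4 < card (orbit_of GG l)"
    using card_orbit[OF assms] by auto
qed

text \<open>Degrees decide: a norm has degree 8 or 16, while members of a homogeneous minimal
  generating set have degree 1 or 4.\<close>

lemma no_orbit_norm_in_minimal_generating_set:
  assumes B: "homogeneous_minimal_generating_set (invariants GG) B"
  shows "B \<inter> nonlinear_orbit_norms GG = {}"
proof (rule ccontr)
  assume "B \<inter> nonlinear_orbit_norms GG \<noteq> {}"
  then obtain l where l: "linear_form l" "\<not> fixed_by GG l" "orbit_norm GG l \<in> B"
    by (auto simp: nonlinear_orbit_norms_def)
  have "finite B" "image_mset total_degree (mset_set B) = {#1, 1, 4, 4#}"
    using minimal_generator_degrees_gen B by (simp_all add: minimal_generator_degrees_def invariants_GG)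
  with l(3) have "total_degree (orbit_norm GG l) \<in># {#1, 1, 4, 4#}"
    by (metis elem_mset_set image_eqI set_image_mset)
  moreover have "total_degree (orbit_norm GG l) = card (orbit_of GG l)"
    by (rule total_degree_eq[OF homogeneous_orbit_norm[OF l(1)] orbit_norm_neq_0[OF l(2)]])
  ultimately show False
    using card_orbit[OF l(1,2)] by auto
qed

theorem theorem1p2:
  fixes G :: "(xy_var, f8) aut_monoid"
  assumes "G = subgroup_generated graded_aut_group {\<sigma>1, \<sigma>2, \<sigma>3, \<sigma>4}"
  shows "{\<sigma>1, \<sigma>2, \<sigma>3, \<sigma>4} \<subseteq> carrier graded_aut_group \<and>
    faithful_action G UNIV (\<lambda>g. g) \<and>
    G \<cong> product_group {..<4::nat} (\<lambda>_. integer_mod_group 2) \<and>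
    polynomial_algebra (invariants G) \<and>
    minimal_generator_degrees (invariants G) {#1, 1, 4, 4#} \<and>
    (\<forall>l. linear_form l \<and> \<not> fixed_by G l \<longrightarrow> card (orbit_of G l) \<in> {8, 16}) \<and>
    nonlinear_orbit_norms G \<subseteq> positive_invariants_squared G \<and>
    (\<forall>B. homogeneous_minimal_generating_set (invariants G) B \<longrightarrow>
       B \<inter> nonlinear_orbit_norms G = {}) \<and>
    modular_group G \<and>
    \<not> wehlau_norm_conjecture_polynomial TYPE(xy_var) TYPE(f8) \<and>
    \<not> wehlau_norm_conjecture_unrestricted TYPE(xy_var) TYPE(f8)"
proof -
  have G: "G = GG"
    by (simp add: assms GG_def)
  have poly: "polynomial_algebra (invariants GG)"
    unfolding invariants_GG by (rule polynomial_algebra_range[OF inj_gen])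
  have no_norm: "\<not> norm_prediction GG"
    using no_orbit_norm_in_minimal_generating_set unfolding norm_prediction_def by blast
  show ?thesis
    unfolding G
  proof (intro conjI allI impI)
    show "minimal_generator_degrees (invariants GG) {#1, 1, 4, 4#}"
      unfolding invariants_GG by (rule minimal_generator_degrees_gen)
    show "card (orbit_of GG l) \<in> {8, 16}" if "linear_form l \<and> \<not> fixed_by GG l" for l
      using that card_orbit by blast
    show "nonlinear_orbit_norms GG \<subseteq> positive_invariants_squared GG"
      using orbit_norm_in_positive_invariants_squared unfolding nonlinear_orbit_norms_def by blast
    show "\<not> wehlau_norm_conjecture_polynomial TYPE(xy_var) TYPE(f8)"
      using modular_GG poly no_norm unfolding wehlau_norm_conjecture_polynomial_def by blast
    show "\<not> wehlau_norm_conjecture_unrestricted TYPE(xy_var) TYPE(f8)"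
      using modular_GG no_norm unfolding wehlau_norm_conjecture_unrestricted_def by blast
  qed (fact \<sigma>_graded faithful_GG GG_iso poly modular_GG no_orbit_norm_in_minimal_generating_set)+
qed

end
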